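(* Let $X$ be a compact space, let $\mu$ be a probability measure on $X$, let $T : X \to X$ be a bijective measurable map with measurable inverse such that $\mu$ is $T$-ergodic (that is, $T$-invariant and ergodic), and let $\alpha$ be a finite measurable partition of $X$. For integers $n,m\ge 0$ and $x\in X$, let $C_{n,m,\alpha}^T(x)$ denote the element of the partition $\alpha\vee T\alpha\vee\cdots\vee T^m\alpha\vee T^{-1}\alpha\vee\cdots\vee T^{-n}\alpha$ that contains $x$. Then for $\mu$-almost all $x\in X$, $$\lim_{n+m\to\infty}\frac{-1}{n+m}\log\mu\left(C_{n,m,\alpha}^T(x)\right)=h_\mu(T,\alpha),$$ where $h_\mu(T,\alpha)$ is the metric entropy of $T$ with respect to the partition $\alpha$.
   Context: Measurability is with respect to the Borel $\sigma$-algebra of $X$. For $j\in\mathbb{Z}$, $T^j\alpha=\{T^j(A): A\in\alpha\}$, and $\vee$ denotes the join (common refinement) of partitions. The limit as $n+m\to\infty$ is the double-index limit: $\lim_{n+m\to\infty}a_{n,m}=a$ means that for every $\varepsilon>0$ there is $K$ such that $|a_{n,m}-a|<\varepsilon$ for all integers $n,m\ge 0$ with $n+m\ge K$. For finite measurable partitions $\alpha,\beta$, the conditional information function is $$I(\alpha\vert\beta)(x)=-\sum_{A\in\alpha,\,B\in\beta}\chi_{A\cap B}(x)\log\left(\frac{\mu(A\cap B)}{\mu(B)}\right)$$ (defined for $\mu$-almost every $x$), where $\chi_E$ is the characteristic function of $E$. The metric entropy of $T$ with respect to $\alpha$ is $$h_\mu(T,\alpha)=\lim_{n\to\infty}\int_X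 I\left(\alpha\,\Big\vert\,\vee_{k=1}^n T^k\alpha\right)(x)\,d\mu(x).$$ This is the usual Kolmogorov-Sinai entropy of $T$ relative to $\alpha$. *)

theory Defs
  imports "HOL-Probability.Probability"
begin

definition ergodic_measure :: "'a measure \<Rightarrow> ('a \<Rightarrow> 'a) \<Rightarrow> bool" where
  "ergodic_measure M T \<longleftrightarrow>
     (\<forall>A\<in>sets M. measure M (T -` A \<inter> space M) = measure M A) \<and>
     (\<forall>A\<in>sets M. T -` A \<inter> space M = A \<longrightarrow> measure M A = 0 \<or> measure M A = 1)"

definition finite_measurable_partition :: "'a measure \<Rightarrow> 'a set set \<Rightarrow> bool" where
  "finite_measurable_partition M \<alpha> \<longleftrightarrow>
     finite \<alpha> \<and> \<alpha> \<subseteq> sets M \<and> partition_on (space M) \<alpha>"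

text \<open>The integer iterates of a bijection \<open>T\<close> of the set \<open>X\<close>; only the values on \<open>X\<close> matter.\<close>

definition iter_int :: "'a set \<Rightarrow> ('a \<Rightarrow> 'a) \<Rightarrow> int \<Rightarrow> 'a \<Rightarrow> 'a" where
  "iter_int X T j = (if 0 \<le> j then T ^^ nat j else inv_into X T ^^ nat (- j))"

definition shift_partition :: "'a set \<Rightarrow> ('a \<Rightarrow> 'a) \<Rightarrow> int \<Rightarrow> 'a set set \<Rightarrow> 'a set set" where
  "shift_partition X T j \<alpha> = (\<lambda>A. iter_int X T j ` A) ` \<alpha>"

text \<open>
  The join of the partitions \<open>T\<^sup>j \<alpha>\<close> with \<open>j\<close> ranging over the nonempty set \<open>J\<close>. The constant
  \<^const>\<open>common_refinement\<close> takes a set of partitions; that coinciding \<open>T\<^sup>j \<alpha>\<close> are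
  counted only once does not change the join.
\<close>

definition join_partition :: "'a set \<Rightarrow> ('a \<Rightarrow> 'a) \<Rightarrow> int set \<Rightarrow> 'a set set \<Rightarrow> 'a set set" where
  "join_partition X T J \<alpha> = common_refinement ((\<lambda>j. shift_partition X T j \<alpha>) ` J)"

text \<open>On null cells the conventions \<open>ln 0 = 0\<close> and \<open>x / 0 = 0\<close> only affect a null set of points.\<close>

definition cond_information :: "'a measure \<Rightarrow> 'a set set \<Rightarrow> 'a set set \<Rightarrow> 'a \<Rightarrow> real" where
  "cond_information M \<alpha> \<beta> x =
     - (\<Sum>A\<in>\<alpha>. \<Sum>B\<in>\<beta>. indicator (A \<inter> B) x * ln (measure M (A \<inter> B) / measure M B))"

definition metric_entropy :: "'a measure \<Rightarrow> ('a \<Rightarrow> 'a) \<Rightarrow> 'a set set \<Rightarrow> real" where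
  "metric_entropy M T \<alpha> =
     lim (\<lambda>n. \<integral>x. cond_information M \<alpha> (join_partition (space M) T {1..int n} \<alpha>) x \<partial>M)"

definition cell :: "'a set \<Rightarrow> ('a \<Rightarrow> 'a) \<Rightarrow> 'a set set \<Rightarrow> nat \<Rightarrow> nat \<Rightarrow> 'a \<Rightarrow> 'a set" where
  "cell X T \<alpha> n m x = (THE C. C \<in> join_partition X T {- int n..int m} \<alpha> \<and> x \<in> C)"

text \<open>
  The filter of the limit \<open>n + m \<longlongrightarrow> \<infinity>\<close>. It differs from \<^const>\<open>at_top\<close> on pairs, for which both
  indices have to grow.
\<close>

definition sum_at_top :: "(nat \<times> nat) filter" where
  "sum_at_top = filtercomap (\<lambda>(n, m). n + m) at_top"

lemma tendsto_sum_at_top_iff: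
  fixes a :: "nat \<times> nat \<Rightarrow> real"
  shows "(a \<longlongrightarrow> l) sum_at_top \<longleftrightarrow>
    (\<forall>\<epsilon>>0. \<exists>K. \<forall>n m. K \<le> n + m \<longrightarrow> \<bar>a (n, m) - l\<bar> < \<epsilon>)"
  by (simp add: tendsto_iff sum_at_top_def eventually_filtercomap_at_top_linorder dist_real_def)

end

theory Submission
  imports Defs
begin

text \<open>
  Let \<open>f\<^sub>k(x)\<close> be the information of the atom of \<open>x\<close> given the join of \<open>T\<alpha>, \<dots>, T\<^sup>k\<alpha>\<close>. Peeling off the
  partitions \<open>T\<^sup>j\<alpha>\<close> with \<open>-n \<le> j \<le> m\<close> one at a time and using invariance, \<open>- ln \<mu>(C\<^sub>n\<^sub>,\<^sub>m(x))\<close> is the sum of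
  \<open>f\<^sub>m\<^sub>+\<^sub>i(T\<^sup>i x)\<close> over \<open>-m \<le> i \<le> n\<close>. The conditional probabilities in \<open>f\<^sub>k\<close> form bounded martingales, so \<open>f\<^sub>k\<close>
  converges almost everywhere to some \<open>f\<close>; a maximal inequality makes \<open>sup\<^sub>k f\<^sub>k\<close> integrable, whence
  \<open>\<integral>f = lim \<integral>f\<^sub>k\<close> is the entropy. Birkhoff's theorem for \<open>T\<close> and \<open>T\<^sup>-\<^sup>1\<close> bounds the deviation of the sums of
  \<open>f\<close> over the windows \<open>[-m, n]\<close> by \<open>\<epsilon>(n + m) + C(x)\<close>, uniformly over all windows containing \<open>0\<close>, and does the
  same for the sums of \<open>\<bar>f\<^sub>k - f\<bar>\<close>, which is at most an integrable function of small integral apart from a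
  bounded contribution of finitely many \<open>k\<close>.
\<close>

section \<open>Birkhoff sums of an ergodic map\<close>

locale ergodic_system = prob_space M for M :: "'a measure" +
  fixes T :: "'a \<Rightarrow> 'a"
  assumes T_measurable [measurable]: "T \<in> measurable M M"
    and ergodic: "ergodic_measure M T"
begin

lemma distr_T: "distr M M T = M"
proof (rule measure_eqI)
  fix A assume "A \<in> sets (distr M M T)"
  then have A: "A \<in> sets M" by simp
  then show "emeasure (distr M M T) A = emeasure M A"
    using ergodic by (simp add: emeasure_distr ergodic_measure_def emeasure_eq_measure)
qed simp

lemma integrable_comp_T:
  fixes f :: "'a \<Rightarrow> real"
  assumes "integrable M f"
  shows "integrable M (\<lambda>x. f (T x))"
  using assms integrable_distr[of T M M f] by (simp add: distr_T)

lemma integral_comp_T: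
  fixes f :: "'a \<Rightarrow> real"
  assumes "f \<in> borel_measurable M"
  shows "(\<integral>x. f (T x) \<partial>M) = (\<integral>x. f x \<partial>M)"
  using assms integral_distr[of T M M f] by (simp add: distr_T)

end

text \<open>This is the maximum of the Birkhoff sums of length 0 to \<open>n\<close>. The recursion
  compares stage \<open>Suc n\<close> at \<open>x\<close> with stage \<open>n\<close> at
  \<open>T x\<close>, on which the invariance and the limit in \<open>birkhoff_bounded\<close>
  rest.\<close>

primrec max_birkhoff :: "('a \<Rightarrow> 'a) \<Rightarrow> ('a \<Rightarrow> real) \<Rightarrow> nat \<Rightarrow> 'a \<Rightarrow> real" where
  "max_birkhoff T f 0 x = 0"
| "max_birkhoff T f (Suc n) x = max 0 (f x + max_birkhoff T f n (T x))"

lemma max_birkhoff_nonneg: "0 \<le> max_birkhoff T f n x"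
  by (cases n) auto

lemma max_birkhoff_mono: "max_birkhoff T f n x \<le> max_birkhoff T f (Suc n) x"
proof (induction n arbitrary: x)
  case (Suc n)
  from Suc[of "T x"] show ?case by simp
qed simp

lemma birkhoff_sum_Suc:
  fixes f :: "'a \<Rightarrow> real"
  shows "(\<Sum>j<Suc n. f ((T ^^ j) x)) = f x + (\<Sum>j<n. f ((T ^^ j) (T x)))"
  unfolding sum.lessThan_Suc_shift by (simp add: funpow_swap1)

lemma birkhoff_sum_le_max_birkhoff: "(\<Sum>j<n. f ((T ^^ j) x)) \<le> max_birkhoff T f n x"
proof (induction n arbitrary: x)
  case (Suc n)
  show ?case unfolding birkhoff_sum_Suc using Suc[of "T x"] by simp
qed simp

context ergodic_system
begin

lemma max_birkhoff_integrable:
  assumes "integrable M f"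
  shows "integrable M (max_birkhoff T f n)"
proof (induction n)
  case 0
  show ?case by (simp cong: integrable_cong)
next
  case (Suc n)
  have "integrable M (\<lambda>x. max 0 (f x + max_birkhoff T f n (T x)))"
    using assms integrable_comp_T[OF Suc] by (intro integrable_max) auto
  then show ?case by (simp cong: integrable_cong)
qed

text \<open>On the invariant set where the sums are unbounded, \<open>max_birkhoff T f (Suc n) - max_birkhoff T f n \<circ> T\<close>
  tends to \<open>f\<close>, while its integral is nonnegative by monotonicity and invariance.\<close>

lemma birkhoff_bounded:
  fixes f :: "'a \<Rightarrow> real"
  assumes f: "integrable M f" and neg: "(\<integral>x. f x \<partial>M) < 0"
  shows "AE x in M. \<exists>C. \<forall>n. (\<Sum>j<n. f ((T ^^ j) x)) \<le> C"
proof -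
  let ?M = "max_birkhoff T f"
  have [measurable]: "?M n \<in> borel_measurable M" for n
    using max_birkhoff_integrable[OF f] by (rule borel_measurable_integrable)
  have [measurable]: "f \<in> borel_measurable M" using f by auto
  define E where "E = {x \<in> space M. \<forall>K::nat. \<exists>n. real K < ?M n x}"
  have E: "E \<in> sets M" unfolding E_def by measurable
  \<comment> \<open>Passing from \<open>x\<close> to \<open>T x\<close> changes large values by
    \<open>f x\<close> only, so unboundedness is a property of the orbit.\<close>
  have inv: "(\<forall>K::nat. \<exists>n. real K < ?M n x) \<longleftrightarrow> (\<forall>K::nat. \<exists>n. real K < ?M n (T x))" for x
  proof (intro iffI allI)
    fix K :: nat assume *: "\<forall>K::nat. \<exists>n. real K < ?M n x"
    obtain L :: nat where L: "real K + \<bar>f x\<bar> < L" using reals_Archimedean2 by blast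
    obtain n where n: "real L < ?M n x" using * by auto
    have "n \<noteq> 0" using n by (metis max_birkhoff.simps(1) of_nat_0_le_iff not_less)
    then obtain n' where "n = Suc n'" by (cases n) auto
    with n L have "real K < ?M n' (T x)" by (auto simp: max_def split: if_splits)
    then show "\<exists>n. real K < ?M n (T x)" by blast
  next
    fix K :: nat assume *: "\<forall>K::nat. \<exists>n. real K < ?M n (T x)"
    obtain L :: nat where L: "real K + \<bar>f x\<bar> < L" using reals_Archimedean2 by blast
    obtain n where n: "real L < ?M n (T x)" using * by auto
    with L have "real K < ?M (Suc n) x" by (auto simp: max_def)
    then show "\<exists>n. real K < ?M n x" by blast
  qed
  have "T -` E \<inter> space M = E"
    using measurable_space[OF T_measurable] unfolding E_def by (auto simp: inv[symmetric])
  then have "measure M E = 0 \<or> measure M E = 1"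
    using ergodic E by (auto simp: ergodic_measure_def)
  moreover have "measure M E \<noteq> 1"
  proof
    assume 1: "measure M E = 1"
    have AE_E: "AE x in M. x \<in> E" using prob_Collect_eq_1 E 1 AE_prob_1 by blast
    \<comment> \<open>With \<open>t = max_birkhoff T f n (T x)\<close>, \<open>u n x\<close> is
      \<open>max (- t) (f x)\<close>. As \<open>t\<close> is nonnegative, this is dominated by
      \<open>\<bar>f x\<bar>\<close>, and it equals \<open>f x\<close> once \<open>t\<close> exceeds
      \<open>\<bar>f x\<bar>\<close>.\<close>
    define u where "u n x = ?M (Suc n) x - ?M n (T x)" for n x
    have "(\<lambda>n. \<integral>x. u n x \<partial>M) \<longlonglongrightarrow> (\<integral>x. f x \<partial>M)"
    proof (rule integral_dominated_convergence)
      show "integrable M (\<lambda>x. \<bar>f x\<bar>)" using f by auto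
      show "AE x in M. (\<lambda>n. u n x) \<longlonglongrightarrow> f x"
      proof (rule AE_mp[OF AE_E], intro AE_I2 impI)
        fix x assume "x \<in> E"
        then have *: "\<forall>K::nat. \<exists>n. real K < ?M n (T x)" using inv by (auto simp: E_def)
        obtain K :: nat where K: "\<bar>f x\<bar> < K" using reals_Archimedean2 by blast
        obtain n0 where n0: "real K < ?M n0 (T x)" using * by auto
        have "?M n0 (T x) \<le> ?M n (T x)" if "n \<ge> n0" for n
          using that by (rule lift_Suc_mono_le[rotated]) (rule max_birkhoff_mono)
        then have "\<forall>n\<ge>n0. u n x = f x" using n0 K by (force simp: u_def max_def)
        then have "eventually (\<lambda>n. u n x = f x) sequentially"
          by (auto simp: eventually_sequentially)
        then show "(\<lambda>n. u n x) \<longlonglongrightarrow> f x" by (rule tendsto_eventually)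
      qed
      have "norm (u n x) \<le> \<bar>f x\<bar>" for n x
        using max_birkhoff_nonneg[of T f n "T x"] by (auto simp: u_def max_def abs_if)
      then show "AE x in M. norm (u n x) \<le> \<bar>f x\<bar>" for n by simp
    qed (auto simp: u_def simp del: max_birkhoff.simps)
    moreover have "0 \<le> (\<integral>x. u n x \<partial>M)" for n
    proof -
      have "(\<integral>x. u n x \<partial>M) = (\<integral>x. ?M (Suc n) x \<partial>M) - (\<integral>x. ?M n x \<partial>M)"
        unfolding u_def using max_birkhoff_integrable[OF f] integrable_comp_T
        by (subst Bochner_Integration.integral_diff) (auto simp: integral_comp_T simp del: max_birkhoff.simps)
      moreover have "(\<integral>x. ?M n x \<partial>M) \<le> (\<integral>x. ?M (Suc n) x \<partial>M)"
        using max_birkhoff_integrable[OF f] max_birkhoff_mono by (intro integral_mono) (auto simp del: max_birkhoff.simps)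
      ultimately show ?thesis by simp
    qed
    ultimately have "0 \<le> (\<integral>x. f x \<partial>M)" by (meson LIMSEQ_le_const)
    with neg show False by simp
  qed
  ultimately have "measure M E = 0" by simp
  then have "AE x in M. x \<notin> E" using E by (simp add: prob_eq_0)
  then show ?thesis
  proof (rule AE_mp, intro AE_I2 impI)
    fix x assume "x \<in> space M" "x \<notin> E"
    then have "\<exists>K::nat. \<forall>n. ?M n x \<le> K" by (simp add: E_def not_less)
    then obtain K :: nat where K: "\<And>n. ?M n x \<le> K" by metis
    have "\<forall>n. (\<Sum>j<n. f ((T ^^ j) x)) \<le> K"
      by (intro allI order_trans[OF birkhoff_sum_le_max_birkhoff K])
    then show "\<exists>C. \<forall>n. (\<Sum>j<n. f ((T ^^ j) x)) \<le> C" by blast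
  qed
qed

text \<open>Subtracting the constant \<open>(\<integral>x. f x \<partial>M) + e\<close> makes the
  mean negative, so \<open>birkhoff_bounded\<close> applies. Lower estimates come from applying this
  to the negated function.\<close>

lemma birkhoff_upper:
  fixes f :: "'a \<Rightarrow> real"
  assumes f: "integrable M f" and e: "0 < e"
  shows "AE x in M. \<exists>C. \<forall>n. (\<Sum>j<n. f ((T ^^ j) x)) \<le> real n * ((\<integral>x. f x \<partial>M) + e) + C"
proof -
  let ?c = "(\<integral>x. f x \<partial>M) + e"
  have "AE x in M. \<exists>C. \<forall>n. (\<Sum>j<n. f ((T ^^ j) x) - ?c) \<le> C"
    by (rule birkhoff_bounded) (use f e in \<open>auto simp: prob_space\<close>)
  then show ?thesis
    by (rule AE_mp) (auto simp: sum_subtractf algebra_simps)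
qed

end

section \<open>Martingales of conditional probabilities over refining finite partitions\<close>

lemma (in finite_measure) measure_UN_incseq_le:
  assumes "range E \<subseteq> sets M" "incseq E" "\<And>n. measure M (E n) \<le> c"
  shows "measure M (\<Union>n::nat. E n) \<le> c"
  using finite_Lim_measure_incseq[OF assms(1,2)] assms(3) by (meson LIMSEQ_le_const2)

text \<open>\<open>B k x\<close> plays the cell of \<open>x\<close> in the \<open>k\<close>-th of a
  refining sequence of finite partitions. Working with the cells of points turns conditional
  expectations into finite sums.\<close>

locale nested_cells = prob_space M for M :: "'a measure" +
  fixes B :: "nat \<Rightarrow> 'a \<Rightarrow> 'a set"
  assumes cell_sets: "x \<in> space M \<Longrightarrow> B k x \<in> sets M"
    and mem_cell: "x \<in> space M \<Longrightarrow> x \<in> B k x"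
    and cell_eq: "x \<in> space M \<Longrightarrow> y \<in> B k x \<Longrightarrow> B k y = B k x"
    and cell_antimono: "x \<in> space M \<Longrightarrow> B (Suc k) x \<subseteq> B k x"
    and finite_cells: "finite (B k ` space M)"
begin

text \<open>This replaces measurability with respect to the \<open>k\<close>-th partition.\<close>

definition cell_const :: "nat \<Rightarrow> ('a \<Rightarrow> real) \<Rightarrow> bool" where
  "cell_const k \<phi> \<longleftrightarrow> (\<forall>x\<in>space M. \<forall>y\<in>B k x. \<phi> y = \<phi> x)"

definition cell_value :: "('a \<Rightarrow> real) \<Rightarrow> 'a set \<Rightarrow> real" where
  "cell_value \<phi> C = \<phi> (SOME y. y \<in> C)"

text \<open>The conditional probability of \<open>A\<close> given the \<open>k\<close>-th partition;
  division by zero makes it 0 on null cells.\<close>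

definition cell_density :: "'a set \<Rightarrow> nat \<Rightarrow> 'a \<Rightarrow> real" where
  "cell_density A k x = measure M (A \<inter> B k x) / measure M (B k x)"

lemma cell_subset_space: "x \<in> space M \<Longrightarrow> B k x \<subseteq> space M"
  using cell_sets sets.sets_into_space by blast

lemma cell_antimono_le: "x \<in> space M \<Longrightarrow> k \<le> l \<Longrightarrow> B l x \<subseteq> B k x"
  by (rule lift_Suc_antimono_le[of "\<lambda>k. B k x"]) (auto dest: cell_antimono)

lemma cell_const_mono: "cell_const k \<phi> \<Longrightarrow> k \<le> l \<Longrightarrow> cell_const l \<phi>"
  unfolding cell_const_def using cell_antimono_le by blast

lemma cell_const_density: "cell_const k (cell_density A k)"
  unfolding cell_const_def cell_density_def by (auto simp: cell_eq)

lemma cell_const_diff: "cell_const k f \<Longrightarrow> cell_const k g \<Longrightarrow> cell_const k (\<lambda>x. f x - g x)"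
  and cell_const_mult: "cell_const k f \<Longrightarrow> cell_const k g \<Longrightarrow> cell_const k (\<lambda>x. f x * g x)"
  by (auto simp: cell_const_def)

lemma cell_value_eq:
  assumes "cell_const k \<phi>" "x \<in> space M"
  shows "cell_value \<phi> (B k x) = \<phi> x"
proof -
  have "(SOME y. y \<in> B k x) \<in> B k x" using mem_cell[OF assms(2)] by (rule someI)
  then show ?thesis using assms by (auto simp: cell_value_def cell_const_def)
qed

lemma cell_const_expand:
  assumes "cell_const k \<phi>" "x \<in> space M"
  shows "\<phi> x = (\<Sum>C\<in>B k ` space M. cell_value \<phi> C * indicator C x)"
proof -
  have "C = B k x" if "C \<in> B k ` space M" "x \<in> C" for C
    using that cell_eq by auto
  then have "(\<Sum>C\<in>B k ` space M. cell_value \<phi> C * indicator C x) = (\<Sum>C\<in>{B k x}. cell_value \<phi> C * indicator C x)"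
    using assms(2) finite_cells by (intro sum.mono_neutral_right) (auto simp: indicator_def)
  then show ?thesis using cell_value_eq[OF assms] mem_cell[OF assms(2)] by simp
qed

lemma integrable_cell_const:
  assumes "cell_const k \<phi>"
  shows "integrable M \<phi>"
proof -
  have "integrable M (\<lambda>x. \<Sum>C\<in>B k ` space M. cell_value \<phi> C * indicator C x)"
    using cell_sets by (intro Bochner_Integration.integrable_sum integrable_mult_right)
      (auto simp: integrable_indicator_iff emeasure_eq_measure)
  then show ?thesis
    by (subst Bochner_Integration.integrable_cong[OF refl cell_const_expand[OF assms]])
qed

lemma measurable_cell_density [measurable]: "cell_density A k \<in> borel_measurable M"
  using integrable_cell_const[OF cell_const_density] by (rule borel_measurable_integrable)

lemma integral_cell_const_indicator:
  assumes "cell_const k \<phi>" and A: "A \<in> sets M"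
  shows "(\<integral>x. \<phi> x * indicator A x \<partial>M) = (\<Sum>C\<in>B k ` space M. cell_value \<phi> C * measure M (A \<inter> C))"
proof -
  have "(\<integral>x. \<phi> x * indicator A x \<partial>M) =
      (\<integral>x. (\<Sum>C\<in>B k ` space M. cell_value \<phi> C * indicator (A \<inter> C) x) \<partial>M)"
    by (intro Bochner_Integration.integral_cong refl)
      (simp add: cell_const_expand[OF assms(1)] sum_distrib_right sum_distrib_left indicator_inter_arith mult_ac)
  also have "\<dots> = (\<Sum>C\<in>B k ` space M. \<integral>x. cell_value \<phi> C * indicator (A \<inter> C) x \<partial>M)"
    using cell_sets A by (intro Bochner_Integration.integral_sum integrable_mult_right)
      (auto simp: integrable_indicator_iff emeasure_eq_measure)
  also have "\<dots> = (\<Sum>C\<in>B k ` space M. cell_value \<phi> C * measure M (A \<inter> C))"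
    using cell_sets A sets.sets_into_space by (intro sum.cong refl) (force simp: Int_absorb2)
  finally show ?thesis .
qed

text \<open>The defining property of a conditional expectation. It holds cell by cell: the density
  times the measure of a cell is the measure of what \<open>A\<close> takes of that cell.\<close>

lemma integral_cell_density:
  assumes \<phi>: "cell_const k \<phi>" and A: "A \<in> sets M"
  shows "(\<integral>x. \<phi> x * cell_density A k x \<partial>M) = (\<integral>x. \<phi> x * indicator A x \<partial>M)"
proof -
  have c: "cell_const k (\<lambda>x. \<phi> x * cell_density A k x)"
    using \<phi> by (intro cell_const_mult cell_const_density)
  have "(\<integral>x. \<phi> x * cell_density A k x \<partial>M) = (\<integral>x. (\<phi> x * cell_density A k x) * indicator (space M) x \<partial>M)"
    by (intro Bochner_Integration.integral_cong) auto
  also have "\<dots> = (\<Sum>C\<in>B k ` space M. cell_value (\<lambda>x. \<phi> x * cell_density A k x) C * measure M (space M \<inter> C))"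
    using integral_cell_const_indicator[OF c] by simp
  also have "\<dots> = (\<Sum>C\<in>B k ` space M. cell_value \<phi> C * measure M (A \<inter> C))"
  proof (rule sum.cong[OF refl])
    fix C assume "C \<in> B k ` space M"
    then obtain x where x: "x \<in> space M" "C = B k x" by auto
    \<comment> \<open>On a null cell the density has the default value 0, and the other side
      vanishes there too.\<close>
    have "measure M (A \<inter> B k x) = 0" if "measure M (B k x) = 0"
      using that cell_sets[OF x(1)] by (metis Int_lower2 finite_measure_mono measure_le_0_iff)
    then show "cell_value (\<lambda>x. \<phi> x * cell_density A k x) C * measure M (space M \<inter> C) =
        cell_value \<phi> C * measure M (A \<inter> C)"
      using x cell_value_eq[OF c x(1)] cell_value_eq[OF \<phi> x(1)] cell_subset_space[OF x(1)]
      by (auto simp: cell_density_def Int_absorb1)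
  qed
  finally show ?thesis using integral_cell_const_indicator[OF \<phi> A] by simp
qed

text \<open>The martingale property, tested against functions of level \<open>k\<close>: both sides
  are the integral of \<phi> over \<open>A\<close>.\<close>

lemma integral_cell_density_le:
  assumes "cell_const k \<phi>" "A \<in> sets M" "k \<le> l"
  shows "(\<integral>x. \<phi> x * cell_density A l x \<partial>M) = (\<integral>x. \<phi> x * cell_density A k x \<partial>M)"
  using integral_cell_density[OF assms(1,2)] integral_cell_density[OF cell_const_mono[OF assms(1,3)] assms(2)] by simp

section \<open>Lower bounds for the conditional probabilities\<close>

lemma cell_density_nonneg: "0 \<le> cell_density A k x"
  by (simp add: cell_density_def)

lemma cell_density_le_1: "x \<in> space M \<Longrightarrow> cell_density A k x \<le> 1"
  using cell_sets[of x k] by (auto simp: cell_density_def divide_le_eq_1 intro!: finite_measure_mono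
    order.not_eq_order_implies_strict)

text \<open>Stop at the first \<open>k\<close> with density below \<open>r\<close>. The stopping
  event \<open>E k\<close> is a union of cells of level \<open>k\<close>, so \<open>A\<close> takes
  at most the fraction \<open>r\<close> of it, and these events are disjoint.\<close>

lemma cell_density_maximal:
  assumes A [measurable]: "A \<in> sets M" and r: "0 \<le> r"
  shows "measure M {x \<in> A. \<exists>k. cell_density A k x < r} \<le> r"
proof -
  define E where "E k = {x \<in> space M. cell_density A k x < r \<and> (\<forall>j<k. r \<le> cell_density A j x)}" for k
  have E [measurable]: "E k \<in> sets M" for k unfolding E_def by measurable
  have disj: "disjoint_family_on E {..n}" for n
    unfolding disjoint_family_on_def E_def by (auto, metis linorder_neqE_nat not_le)
  have const: "cell_const k (indicator (E k))" for k
  proof -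
    have "cell_density A j y = cell_density A j x" if "x \<in> space M" "y \<in> B k x" "j \<le> k" for x y j
      using cell_const_mono[OF cell_const_density that(3)] that(1,2) by (auto simp: cell_const_def)
    moreover have "y \<in> space M" if "x \<in> space M" "y \<in> B k x" for x y
      using that cell_subset_space by blast
    ultimately show ?thesis by (auto simp: cell_const_def E_def indicator_def)
  qed
  have le: "measure M (A \<inter> E k) \<le> r * measure M (E k)" for k
  proof -
    have "measure M (A \<inter> E k) = (\<integral>x. indicator (E k) x * indicator A x \<partial>M)"
      by (simp add: indicator_inter_arith[symmetric] Int_commute)
    also have "\<dots> = (\<integral>x. indicator (E k) x * cell_density A k x \<partial>M)"
      using integral_cell_density[OF const A] by simp
    also have "\<dots> \<le> (\<integral>x. indicator (E k) x * r \<partial>M)"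
      by (intro integral_mono integrable_mult_left integrable_cell_const[of k] cell_const_mult const cell_const_density)
        (auto simp: E_def indicator_def)
    finally show ?thesis by (simp add: mult.commute)
  qed
  have "measure M (\<Union>n. \<Union>k\<le>n. A \<inter> E k) \<le> r"
  proof (rule measure_UN_incseq_le)
    fix n
    have "measure M (\<Union>k\<le>n. A \<inter> E k) \<le> (\<Sum>k\<le>n. measure M (A \<inter> E k))"
      by (intro measure_UNION_le) auto
    also have "\<dots> \<le> (\<Sum>k\<le>n. r * measure M (E k))"
      by (intro sum_mono le)
    also have "\<dots> = r * measure M (\<Union>k\<le>n. E k)"
      using finite_measure_finite_Union[OF _ _ disj[of n]] by (simp add: sum_distrib_left image_subset_iff)
    also have "\<dots> \<le> r * 1" using r by (intro mult_left_mono) auto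
    finally show "measure M (\<Union>k\<le>n. A \<inter> E k) \<le> r" by simp
  qed (auto intro!: incseq_SucI intro: le_SucI)
  moreover
  have "{x \<in> A. \<exists>k. cell_density A k x < r} \<subseteq> (\<Union>n. \<Union>k\<le>n. A \<inter> E k)"
  proof
    fix x assume x: "x \<in> {x \<in> A. \<exists>k. cell_density A k x < r}"
    then obtain k where "cell_density A k x < r" "\<forall>j<k. \<not> cell_density A j x < r"
      using exists_least_iff[of "\<lambda>k. cell_density A k x < r"] by auto
    then show "x \<in> (\<Union>n. \<Union>k\<le>n. A \<inter> E k)"
      using x sets.sets_into_space[OF A] by (auto simp: E_def not_less)
  qed
  then have "measure M {x \<in> A. \<exists>k. cell_density A k x < r} \<le> measure M (\<Union>n. \<Union>k\<le>n. A \<inter> E k)"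
    by (intro finite_measure_mono) auto
  ultimately show ?thesis by simp
qed

text \<open>By the maximal inequality, the points of \<open>A\<close> whose densities have infimum 0
  lie, for each \<open>p\<close>, in a set of measure at most \<open>1 / Suc p\<close>.\<close>

lemma cell_density_bounded_below:
  assumes A [measurable]: "A \<in> sets M"
  shows "AE x in M. x \<in> A \<longrightarrow> (\<exists>\<delta>>0. \<forall>k. \<delta> \<le> cell_density A k x)"
proof -
  define N where "N = {x \<in> space M. x \<in> A \<and> (\<forall>p::nat. \<exists>k. cell_density A k x < 1 / real (Suc p))}"
  have N: "N \<in> sets M" unfolding N_def by measurable
  have "measure M N \<le> 1 / real (Suc p)" for p
  proof -
    have "measure M N \<le> measure M {x \<in> A. \<exists>k. cell_density A k x < 1 / real (Suc p)}"
    proof (rule finite_measure_mono)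
      have "{x \<in> A. \<exists>k. cell_density A k x < 1 / real (Suc p)} =
          {x \<in> space M. x \<in> A \<and> (\<exists>k. cell_density A k x < 1 / real (Suc p))}"
        using sets.sets_into_space[OF A] by auto
      also have "\<dots> \<in> sets M" by measurable
      finally show "{x \<in> A. \<exists>k. cell_density A k x < 1 / real (Suc p)} \<in> sets M" .
    qed (auto simp: N_def)
    then show ?thesis using cell_density_maximal[OF A, of "1 / real (Suc p)"] by simp
  qed
  then have "measure M N \<le> 0"
    using LIMSEQ_inverse_real_of_nat by (intro LIMSEQ_le_const[of "\<lambda>p. inverse (real (Suc p))"]) (auto simp: inverse_eq_divide)
  then have "measure M N = 0" by (simp add: measure_le_0_iff)
  then have "AE x in M. x \<notin> N" using N by (simp add: prob_eq_0)
  then show ?thesis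
  proof (rule AE_mp, intro AE_I2 impI)
    fix x assume "x \<in> space M" "x \<notin> N" "x \<in> A"
    then obtain p :: nat where "\<forall>k. 1 / real (Suc p) \<le> cell_density A k x" by (auto simp: N_def not_less)
    then show "\<exists>\<delta>>0. \<forall>k. \<delta> \<le> cell_density A k x" by (intro exI[of _ "1 / real (Suc p)"]) auto
  qed
qed

text \<open>Pythagoras for martingales: testing against the earlier density turns the mixed term
  into the integral of its square.\<close>

lemma integral_cell_density_sq_diff:
  assumes A: "A \<in> sets M" and "k \<le> l"
  shows "(\<integral>x. (cell_density A l x - cell_density A k x)\<^sup>2 \<partial>M) = (\<integral>x. (cell_density A l x)\<^sup>2 \<partial>M) - (\<integral>x. (cell_density A k x)\<^sup>2 \<partial>M)"
proof -
  note c = cell_const_density[of l A] cell_const_mono[OF cell_const_density \<open>k \<le> l\<close>, of A]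
  note i = integrable_cell_const[OF cell_const_mult]
  have "(\<integral>x. (cell_density A l x - cell_density A k x)\<^sup>2 \<partial>M) =
      (\<integral>x. (cell_density A l x * cell_density A l x - (2 * (cell_density A k x * cell_density A l x)) + cell_density A k x * cell_density A k x) \<partial>M)"
    by (intro Bochner_Integration.integral_cong refl) (simp add: power2_eq_square algebra_simps)
  also have "\<dots> = (\<integral>x. cell_density A l x * cell_density A l x \<partial>M) - 2 * (\<integral>x. cell_density A k x * cell_density A l x \<partial>M)
       + (\<integral>x. cell_density A k x * cell_density A k x \<partial>M)"
    using i[OF c(1) c(1)] i[OF c(2) c(1)] i[OF c(2) c(2)] by simp
  finally show ?thesis
    using integral_cell_density_le[OF cell_const_density A \<open>k \<le> l\<close>] by (simp add: power2_eq_square)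
qed

text \<open>Kolmogorov's inequality: after the first time \<open>k\<close> at which the density has moved by \<open>\<epsilon>\<close>,
  its increments are orthogonal to what happened before.\<close>

lemma cell_density_kolmogorov:
  assumes A [measurable]: "A \<in> sets M" and \<epsilon>: "0 < \<epsilon>"
  shows "\<epsilon>\<^sup>2 * measure M {x \<in> space M. \<exists>k. l \<le> k \<and> k \<le> n \<and> \<epsilon> \<le> \<bar>cell_density A k x - cell_density A l x\<bar>}
    \<le> (\<integral>x. (cell_density A n x - cell_density A l x)\<^sup>2 \<partial>M)"
proof -
  let ?d = "\<lambda>k x. cell_density A k x - cell_density A l x"
  define E where "E k = {x \<in> space M. \<epsilon> \<le> \<bar>?d k x\<bar> \<and> (\<forall>j. l \<le> j \<and> j < k \<longrightarrow> \<bar>?d j x\<bar> < \<epsilon>)}" for k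
  have E [measurable]: "E k \<in> sets M" for k unfolding E_def by measurable
  have disj: "disjoint_family_on E {l..n}"
    unfolding disjoint_family_on_def E_def by (auto, metis linorder_neqE_nat not_le)
  have const: "cell_const k (indicator (E k))" if "l \<le> k" for k
  proof -
    have "cell_density A j y = cell_density A j x" if "x \<in> space M" "y \<in> B k x" "j \<le> k" for x y j
      using cell_const_mono[OF cell_const_density that(3)] that(1,2) by (auto simp: cell_const_def)
    moreover have "y \<in> space M" if "x \<in> space M" "y \<in> B k x" for x y
      using that cell_subset_space by blast
    ultimately show ?thesis using that by (auto simp: cell_const_def E_def indicator_def)
  qed
  have dconst: "cell_const k (?d j)" if "l \<le> k" "j \<le> k" for k j
    using that by (intro cell_const_diff cell_const_mono[OF cell_const_density])
  have le: "\<epsilon>\<^sup>2 * measure M (E k) \<le> (\<integral>x. indicator (E k) x * (?d n x)\<^sup>2 \<partial>M)" if k: "l \<le> k" "k \<le> n" for k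
  proof -
    let ?\<phi> = "\<lambda>x. indicator (E k) x * ?d k x"
    have \<phi>: "cell_const k ?\<phi>" using const dconst k by (intro cell_const_mult) auto
    have const_n: "cell_const n (indicator (E k))" using const cell_const_mono k by blast
    have int: "integrable M (\<lambda>x. indicator (E k) x * (?d n x)\<^sup>2)"
      unfolding power2_eq_square using dconst k const_n
      by (intro integrable_cell_const[of n] cell_const_mult) auto
    have int': "integrable M (\<lambda>x. ?\<phi> x * cell_density A n x)" "integrable M (\<lambda>x. ?\<phi> x * cell_density A k x)"
      using integrable_cell_const[OF cell_const_mult[OF cell_const_mono[OF \<phi> k(2)] cell_const_density]]
        integrable_cell_const[OF cell_const_mult[OF \<phi> cell_const_density]] by simp_all
    have "\<epsilon>\<^sup>2 * measure M (E k) = (\<integral>x. \<epsilon>\<^sup>2 * indicator (E k) x \<partial>M)" by simp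
    \<comment> \<open>Write \<open>?d n\<close> as \<open>?d k\<close> plus a later increment.
      Removing the mixed term leaves two squares, the first at least
      \<open>\<epsilon>\<^sup>2\<close> on \<open>E k\<close>; the mixed term integrates to 0 by the
      martingale property.\<close>
    also have "\<dots> \<le> (\<integral>x. indicator (E k) x * (?d n x)\<^sup>2 - 2 * (?\<phi> x * cell_density A n x - ?\<phi> x * cell_density A k x) \<partial>M)"
    proof (rule integral_mono)
      fix x assume "x \<in> space M"
      have "\<epsilon>\<^sup>2 \<le> (?d n x)\<^sup>2 - 2 * (?d k x * cell_density A n x - ?d k x * cell_density A k x)" if "x \<in> E k"
      proof -
        have "\<epsilon>\<^sup>2 \<le> (?d k x)\<^sup>2" using that \<epsilon> by (auto simp: E_def abs_le_square_iff[symmetric])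
        also have "\<dots> \<le> (?d k x)\<^sup>2 + (cell_density A n x - cell_density A k x)\<^sup>2" by simp
        also have "\<dots> = (?d n x)\<^sup>2 - 2 * (?d k x * cell_density A n x - ?d k x * cell_density A k x)"
          by (simp add: power2_eq_square algebra_simps)
        finally show ?thesis .
      qed
      then show "\<epsilon>\<^sup>2 * indicator (E k) x \<le> indicator (E k) x * (?d n x)\<^sup>2 - 2 * (?\<phi> x * cell_density A n x - ?\<phi> x * cell_density A k x)"
        by (auto simp: indicator_def)
    qed (use int int' in \<open>auto simp: integrable_indicator_iff emeasure_eq_measure\<close>)
    also have "\<dots> = (\<integral>x. indicator (E k) x * (?d n x)\<^sup>2 \<partial>M)
        - 2 * ((\<integral>x. ?\<phi> x * cell_density A n x \<partial>M) - (\<integral>x. ?\<phi> x * cell_density A k x \<partial>M))"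
      using int int' by simp
    also have "\<dots> = (\<integral>x. indicator (E k) x * (?d n x)\<^sup>2 \<partial>M)"
      using integral_cell_density_le[OF \<phi> A k(2)] by simp
    finally show ?thesis .
  qed
  have int_d: "integrable M (\<lambda>x. (?d n x)\<^sup>2)" if "l \<le> n"
    unfolding power2_eq_square using dconst that by (intro integrable_cell_const[of n] cell_const_mult) auto
  have "{x \<in> space M. \<exists>k. l \<le> k \<and> k \<le> n \<and> \<epsilon> \<le> \<bar>?d k x\<bar>} \<subseteq> (\<Union>k\<in>{l..n}. E k)"
  proof
    fix x assume x: "x \<in> {x \<in> space M. \<exists>k. l \<le> k \<and> k \<le> n \<and> \<epsilon> \<le> \<bar>?d k x\<bar>}"
    then obtain k where "l \<le> k \<and> k \<le> n \<and> \<epsilon> \<le> \<bar>?d k x\<bar>"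
      "\<forall>j<k. \<not> (l \<le> j \<and> j \<le> n \<and> \<epsilon> \<le> \<bar>?d j x\<bar>)"
      using exists_least_iff[of "\<lambda>k. l \<le> k \<and> k \<le> n \<and> \<epsilon> \<le> \<bar>?d k x\<bar>"] by auto
    then show "x \<in> (\<Union>k\<in>{l..n}. E k)" using x by (auto simp: E_def not_le intro!: bexI[of _ k])
  qed
  then have "\<epsilon>\<^sup>2 * measure M {x \<in> space M. \<exists>k. l \<le> k \<and> k \<le> n \<and> \<epsilon> \<le> \<bar>?d k x\<bar>} \<le> \<epsilon>\<^sup>2 * measure M (\<Union>k\<in>{l..n}. E k)"
    by (intro mult_left_mono finite_measure_mono) auto
  also have "\<dots> = (\<Sum>k\<in>{l..n}. \<epsilon>\<^sup>2 * measure M (E k))"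
    using finite_measure_finite_Union[OF _ _ disj] by (simp add: sum_distrib_left image_subset_iff)
  also have "\<dots> \<le> (\<Sum>k\<in>{l..n}. \<integral>x. indicator (E k) x * (?d n x)\<^sup>2 \<partial>M)"
    by (intro sum_mono le) auto
  also have "\<dots> \<le> (\<integral>x. (?d n x)\<^sup>2 \<partial>M)"
  proof (cases "l \<le> n")
    case True
    have int: "integrable M (\<lambda>x. indicator (E k) x * (?d n x)\<^sup>2)" for k
      using int_d[OF True] by (intro integrable_real_mult_indicator[of "E k" M "\<lambda>x. (?d n x)\<^sup>2", simplified mult.commute]) auto
    have "(\<Sum>k\<in>{l..n}. \<integral>x. indicator (E k) x * (?d n x)\<^sup>2 \<partial>M) = (\<integral>x. (\<Sum>k\<in>{l..n}. indicator (E k) x * (?d n x)\<^sup>2) \<partial>M)"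
      using int by (intro Bochner_Integration.integral_sum[symmetric]) auto
    also have "\<dots> \<le> (\<integral>x. (?d n x)\<^sup>2 \<partial>M)"
    proof (rule integral_mono)
      fix x
      have "(\<Sum>k\<in>{l..n}. indicator (E k) x) = (indicator (\<Union>k\<in>{l..n}. E k) x :: real)"
        using disj by (intro indicator_UN_disjoint[symmetric]) auto
      then show "(\<Sum>k\<in>{l..n}. indicator (E k) x * (?d n x)\<^sup>2) \<le> (?d n x)\<^sup>2"
        unfolding sum_distrib_right[symmetric] by (auto simp: indicator_def)
      show "integrable M (\<lambda>x. \<Sum>k\<in>{l..n}. indicator (E k) x * (?d n x)\<^sup>2)"
        by (intro Bochner_Integration.integrable_sum int)
    qed (rule int_d[OF True])
    finally show ?thesis .
  qed simp
  finally show ?thesis .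
qed

text \<open>The second moments \<open>a k\<close> increase and stay below 1, so increments after
  \<open>l\<close> have second moment at most \<open>L - a l\<close>, which tends to 0. By
  Kolmogorov's inequality, oscillations of size \<epsilon> after \<open>l\<close> become improbable,
  so almost every sequence is Cauchy.\<close>

lemma cell_density_convergent:
  assumes A [measurable]: "A \<in> sets M"
  shows "AE x in M. convergent (\<lambda>k. cell_density A k x)"
proof -
  define a where "a k = (\<integral>x. (cell_density A k x)\<^sup>2 \<partial>M)" for k
  have a_int: "integrable M (\<lambda>x. (cell_density A k x)\<^sup>2)" for k
    unfolding power2_eq_square by (intro integrable_cell_const[of k] cell_const_mult cell_const_density)
  have a_diff: "(\<integral>x. (cell_density A l x - cell_density A k x)\<^sup>2 \<partial>M) = a l - a k" if "k \<le> l" for k l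
    using integral_cell_density_sq_diff[OF A that] by (simp add: a_def)
  have "incseq a"
  proof (rule incseq_SucI)
    fix k
    have "0 \<le> (\<integral>x. (cell_density A (Suc k) x - cell_density A k x)\<^sup>2 \<partial>M)" by simp
    then show "a k \<le> a (Suc k)" using a_diff[of k "Suc k"] by simp
  qed
  moreover have "a k \<le> 1" for k
    unfolding a_def using a_int cell_density_le_1 cell_density_nonneg
    by (intro integral_le_const) (auto intro!: AE_I2 simp: power_le_one)
  ultimately obtain L where L: "a \<longlonglongrightarrow> L" "\<forall>k. a k \<le> L"
    using incseq_convergent by blast
  let ?b = "\<lambda>\<epsilon> l x. \<exists>k\<ge>l. \<epsilon> \<le> \<bar>cell_density A k x - cell_density A l x\<bar>"
  have bad: "\<epsilon>\<^sup>2 * measure M {x \<in> space M. ?b \<epsilon> l x} \<le> L - a l" if "0 < \<epsilon>" for \<epsilon> l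
  proof -
    let ?E = "\<lambda>n. {x \<in> space M. \<exists>k. l \<le> k \<and> k \<le> n \<and> \<epsilon> \<le> \<bar>cell_density A k x - cell_density A l x\<bar>}"
    have "measure M (\<Union>n. ?E n) \<le> (L - a l) / \<epsilon>\<^sup>2"
    proof (rule measure_UN_incseq_le)
      show "incseq ?E" by (intro incseq_SucI) (auto intro: le_SucI)
      show "range ?E \<subseteq> sets M" by (intro image_subsetI) measurable
      fix n
      have "\<epsilon>\<^sup>2 * measure M (?E n) \<le> L - a l"
      proof (cases "l \<le> n")
        case True
        then show ?thesis using cell_density_kolmogorov[OF A that, of l n] a_diff[OF True] L(2) by (smt (verit))
      next
        case False
        then have "?E n = {}" by auto
        then show ?thesis using L(2) by (simp only: measure_empty) simp
      qed
      then show "measure M (?E n) \<le> (L - a l) / \<epsilon>\<^sup>2"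
        using that by (simp add: pos_le_divide_eq mult.commute)
    qed
    moreover have "(\<Union>n. ?E n) = {x \<in> space M. ?b \<epsilon> l x}" by auto
    ultimately show ?thesis using that by (simp add: pos_le_divide_eq mult.commute)
  qed
  have "AE x in M. \<exists>l. \<not> ?b \<epsilon> l x" if "0 < \<epsilon>" for \<epsilon>
  proof -
    let ?N = "{x \<in> space M. \<forall>l. ?b \<epsilon> l x}"
    have N: "?N \<in> sets M" by measurable
    have "\<epsilon>\<^sup>2 * measure M ?N \<le> L - a l" for l
    proof -
      have "\<epsilon>\<^sup>2 * measure M ?N \<le> \<epsilon>\<^sup>2 * measure M {x \<in> space M. ?b \<epsilon> l x}"
        by (intro mult_left_mono finite_measure_mono) auto
      then show ?thesis using bad[OF that, of l] by simp
    qed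
    moreover have "(\<lambda>l. L - a l) \<longlonglongrightarrow> L - L" by (intro tendsto_intros L)
    ultimately have "\<epsilon>\<^sup>2 * measure M ?N \<le> 0" by (intro LIMSEQ_le_const) auto
    then have "measure M ?N = 0" using that by (simp add: mult_le_0_iff measure_le_0_iff not_le)
    then have "AE x in M. x \<notin> ?N" using N by (simp add: prob_eq_0)
    then show ?thesis by (rule AE_mp) auto
  qed
  then have "AE x in M. \<forall>p::nat. \<exists>l. \<not> ?b (1 / real (Suc p)) l x"
    by (subst AE_all_countable) auto
  then show ?thesis
  proof (rule AE_mp, intro AE_I2 impI)
    fix x assume *: "\<forall>p::nat. \<exists>l. \<not> ?b (1 / real (Suc p)) l x"
    have "Cauchy (\<lambda>k. cell_density A k x)"
      unfolding Cauchy_altdef2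
    proof (intro allI impI)
      fix e :: real assume "0 < e"
      then obtain p :: nat where p: "1 / real (Suc p) < e" using nat_approx_posE by blast
      obtain l where "\<not> ?b (1 / real (Suc p)) l x" using * by blast
      with p have "\<forall>n\<ge>l. dist (cell_density A n x) (cell_density A l x) < e"
        unfolding dist_real_def by (meson not_le less_trans)
      then show "\<exists>N. \<forall>n\<ge>N. dist (cell_density A n x) (cell_density A N x) < e" by blast
    qed
    then show "convergent (\<lambda>k. cell_density A k x)" by (simp add: Cauchy_convergent_iff)
  qed
qed

end

section \<open>Information functions\<close>

context nested_cells
begin

text \<open>By the maximal inequality, \<open>sup\<^sub>k - ln (cell_density A k x)\<close> exceeds \<open>n\<close> on a subset of \<open>A\<close> of measure
  at most \<open>exp (- n)\<close>.\<close>

lemma neg_ln_cell_density_dominated: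
  assumes A [measurable]: "A \<in> sets M"
  shows "\<exists>h. integrable M h \<and> (\<forall>x. 0 \<le> h x) \<and> (AE x in M. x \<in> A \<longrightarrow> (\<forall>k. - ln (cell_density A k x) \<le> h x))"
proof -
  define E where "E n = {x \<in> space M. x \<in> A \<and> (\<exists>k. cell_density A k x < exp (- real n))}" for n
  have E [measurable]: "E n \<in> sets M" for n unfolding E_def by measurable
  have E_le: "emeasure M (E n) \<le> ennreal (exp (- real n))" for n
  proof -
    have "E n = {x \<in> A. \<exists>k. cell_density A k x < exp (- real n)}"
      using sets.sets_into_space[OF A] by (auto simp: E_def)
    then show ?thesis using cell_density_maximal[OF A, of "exp (- real n)"] by (simp add: emeasure_eq_measure)
  qed
  \<comment> \<open>\<open>H\<close> counts the \<open>n\<close> for which some density falls below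
    \<open>exp (- n)\<close>, so its integral is at most a geometric series. In
    \<open>ennreal\<close> the sum exists without a convergence claim.\<close>
  define H where "H x = (\<Sum>n. indicator (E n) x :: ennreal)" for x
  have [measurable]: "H \<in> borel_measurable M" unfolding H_def by measurable
  have "(\<integral>\<^sup>+x. H x \<partial>M) = (\<Sum>n. emeasure M (E n))"
    unfolding H_def by (subst nn_integral_suminf) auto
  also have "\<dots> \<le> (\<Sum>n. ennreal (exp (- real n)))"
    by (intro suminf_le E_le) auto
  also have "\<dots> = ennreal (\<Sum>n. exp (- real n))"
  proof (rule suminf_ennreal2)
    have "summable (\<lambda>n. exp (- 1 :: real) ^ n)" by (rule summable_geometric) simp
    then show "summable (\<lambda>n. exp (- real n))" by (simp add: exp_of_nat_mult[symmetric])
  qed simp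
  finally have fin: "(\<integral>\<^sup>+x. H x \<partial>M) < \<infinity>" by (simp add: le_less_trans)
  have H_fin: "AE x in M. H x \<noteq> \<infinity>"
    using fin by (intro nn_integral_PInf_AE) auto
  have le_H: "ennreal (- ln (cell_density A k x)) \<le> H x" if x: "x \<in> A" for x k
  proof (cases "0 < - ln (cell_density A k x)")
    case True
    let ?t = "- ln (cell_density A k x)"
    \<comment> \<open>Since \<open>ln 0 = 0\<close>, a positive value of \<open>- ln\<close>
      excludes density 0.\<close>
    have pos: "0 < cell_density A k x"
      using True cell_density_nonneg[of A k x] by (cases "cell_density A k x = 0") auto
    \<comment> \<open>Every \<open>n\<close> below the rounded-up value of \<open>?t\<close> is
      strictly less than \<open>?t\<close>, hence is counted by \<open>H x\<close>.\<close>
    define N where "N = nat \<lceil>?t\<rceil>"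
    have "x \<in> E n" if "n < N" for n
    proof -
      have "real n < ?t" using that unfolding N_def by linarith
      then have "exp (ln (cell_density A k x)) < exp (- real n)" by (intro exp_less_mono) linarith
      then have "cell_density A k x < exp (- real n)" using pos by simp
      then show ?thesis using x sets.sets_into_space[OF A] by (auto simp: E_def)
    qed
    then have "(\<Sum>n<N. indicator (E n) x :: ennreal) = (\<Sum>n<N. 1)" by (intro sum.cong) auto
    then have "(\<Sum>n<N. indicator (E n) x :: ennreal) = of_nat N" by simp
    moreover have "(\<Sum>n<N. indicator (E n) x :: ennreal) \<le> H x"
      unfolding H_def by (rule sum_le_suminf) auto
    moreover have "ennreal ?t \<le> of_nat N"
      unfolding N_def ennreal_of_nat_eq_real_of_nat using True by (intro ennreal_leI) linarith
    ultimately show ?thesis by (metis order_trans)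
  qed (simp add: ennreal_neg)
  show ?thesis
  proof (intro exI[of _ "\<lambda>x. enn2real (H x)"] conjI)
    show "integrable M (\<lambda>x. enn2real (H x))"
    proof (rule integrableI_nonneg)
      have "(\<integral>\<^sup>+x. ennreal (enn2real (H x)) \<partial>M) \<le> (\<integral>\<^sup>+x. H x \<partial>M)"
        by (intro nn_integral_mono) (simp add: ennreal_enn2real_if)
      then show "(\<integral>\<^sup>+x. ennreal (enn2real (H x)) \<partial>M) < \<infinity>" using fin by (rule le_less_trans)
    qed auto
    show "AE x in M. x \<in> A \<longrightarrow> (\<forall>k. - ln (cell_density A k x) \<le> enn2real (H x))"
      using H_fin
    proof eventually_elim
      case (elim x)
      show ?case
      proof (intro impI allI)
        fix k assume "x \<in> A"
        have "ennreal (- ln (cell_density A k x)) \<le> ennreal (enn2real (H x))"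
          using le_H[OF \<open>x \<in> A\<close>] elim by (simp add: less_top)
        then show "- ln (cell_density A k x) \<le> enn2real (H x)"
          by (simp add: ennreal_le_iff)
      qed
    qed
  qed simp
qed

text \<open>This is \<open>cond_information\<close> with the sum over the conditioning partition
  already collapsed to the cell of \<open>x\<close>; \<open>cond_information_eq_info\<close>
  identifies the two.\<close>

definition information :: "'a set set \<Rightarrow> nat \<Rightarrow> 'a \<Rightarrow> real" where
  "information \<alpha> k x = (\<Sum>A\<in>\<alpha>. indicator A x * - ln (cell_density A k x))"

context
  fixes \<alpha> assumes \<alpha>: "finite_measurable_partition M \<alpha>"
begin

lemma finite_atoms: "finite \<alpha>" and atom_sets: "A \<in> \<alpha> \<Longrightarrow> A \<in> sets M"
  and atom_exists: "x \<in> space M \<Longrightarrow> \<exists>A\<in>\<alpha>. x \<in> A"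
  and atom_unique: "A \<in> \<alpha> \<Longrightarrow> A' \<in> \<alpha> \<Longrightarrow> x \<in> A \<Longrightarrow> x \<in> A' \<Longrightarrow> A = A'"
  using \<alpha> unfolding finite_measurable_partition_def partition_on_def disjoint_def by blast+

lemma information_eq:
  assumes "A \<in> \<alpha>" "x \<in> A"
  shows "information \<alpha> k x = - ln (cell_density A k x)"
proof -
  have "information \<alpha> k x = (\<Sum>A\<in>{A}. indicator A x * - ln (cell_density A k x))"
    unfolding information_def using assms atom_unique finite_atoms
    by (intro sum.mono_neutral_right) (auto simp: indicator_def)
  then show ?thesis using assms by simp
qed

lemma information_measurable [measurable]: "information \<alpha> k \<in> borel_measurable M"
  unfolding information_def using atom_sets
  by (intro borel_measurable_sum borel_measurable_times borel_measurable_uminus borel_measurable_ln borel_measurable_indicator) auto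

lemma information_nonneg:
  assumes x: "x \<in> space M"
  shows "0 \<le> information \<alpha> k x"
proof -
  obtain A where A: "A \<in> \<alpha>" "x \<in> A" using atom_exists[OF x] by blast
  show ?thesis unfolding information_eq[OF A]
    using cell_density_le_1[OF x, of A k] cell_density_nonneg[of A k x]
    by (cases "cell_density A k x = 0") auto
qed

text \<open>The partition is finite, so the dominating functions of its atoms can be added.\<close>

lemma information_dominated:
  "\<exists>h. integrable M h \<and> (AE x in M. \<forall>k. \<bar>information \<alpha> k x\<bar> \<le> h x)"
proof -
  obtain h where h: "\<And>A. A \<in> \<alpha> \<Longrightarrow> integrable M (h A) \<and> (\<forall>x. 0 \<le> h A x) \<and>
      (AE x in M. x \<in> A \<longrightarrow> (\<forall>k. - ln (cell_density A k x) \<le> h A x))"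
    using bchoice[of \<alpha> "\<lambda>A h. integrable M h \<and> (\<forall>x. 0 \<le> h x) \<and>
      (AE x in M. x \<in> A \<longrightarrow> (\<forall>k. - ln (cell_density A k x) \<le> h x))"]
      neg_ln_cell_density_dominated[OF atom_sets] by blast
  have "AE x in M. \<forall>A\<in>\<alpha>. x \<in> A \<longrightarrow> (\<forall>k. - ln (cell_density A k x) \<le> h A x)"
    using finite_atoms h by (intro AE_finite_allI) auto
  then have "AE x in M. \<forall>k. \<bar>information \<alpha> k x\<bar> \<le> (\<Sum>A\<in>\<alpha>. h A x)"
  proof (rule AE_mp, intro AE_I2 impI allI)
    fix x k assume x: "x \<in> space M"
      and *: "\<forall>A\<in>\<alpha>. x \<in> A \<longrightarrow> (\<forall>k. - ln (cell_density A k x) \<le> h A x)"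
    obtain A where A: "A \<in> \<alpha>" "x \<in> A" using atom_exists[OF x] by blast
    have "\<bar>information \<alpha> k x\<bar> = - ln (cell_density A k x)"
      using information_nonneg[OF x] information_eq[OF A] by simp
    also have "\<dots> \<le> h A x" using * A by blast
    also have "\<dots> \<le> (\<Sum>A\<in>\<alpha>. h A x)" using A finite_atoms h by (intro member_le_sum) auto
    finally show "\<bar>information \<alpha> k x\<bar> \<le> (\<Sum>A\<in>\<alpha>. h A x)" .
  qed
  then show ?thesis using h by (intro exI[of _ "\<lambda>x. \<Sum>A\<in>\<alpha>. h A x"] conjI Bochner_Integration.integrable_sum) auto
qed

text \<open>Almost everywhere on an atom its densities converge and stay away from 0, so the
  logarithm is continuous at their limit.\<close>

lemma information_convergent: "AE x in M. convergent (\<lambda>k. information \<alpha> k x)"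
proof -
  have "AE x in M. \<forall>A\<in>\<alpha>. convergent (\<lambda>k. cell_density A k x) \<and> (x \<in> A \<longrightarrow> (\<exists>\<delta>>0. \<forall>k. \<delta> \<le> cell_density A k x))"
    using finite_atoms atom_sets cell_density_convergent cell_density_bounded_below
    by (intro AE_finite_allI) auto
  then show ?thesis
  proof (rule AE_mp, intro AE_I2 impI)
    fix x assume x: "x \<in> space M"
      and *: "\<forall>A\<in>\<alpha>. convergent (\<lambda>k. cell_density A k x) \<and> (x \<in> A \<longrightarrow> (\<exists>\<delta>>0. \<forall>k. \<delta> \<le> cell_density A k x))"
    obtain A where A: "A \<in> \<alpha>" "x \<in> A" using atom_exists[OF x] by blast
    obtain L where L: "(\<lambda>k. cell_density A k x) \<longlonglongrightarrow> L" using * A by (auto simp: convergent_def)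
    obtain \<delta> where \<delta>: "0 < \<delta>" "\<And>k. \<delta> \<le> cell_density A k x" using * A by blast
    have "0 < L" using LIMSEQ_le_const[OF L, of \<delta>] \<delta> by fastforce
    then have "(\<lambda>k. - ln (cell_density A k x)) \<longlonglongrightarrow> - ln L"
      by (intro tendsto_minus tendsto_ln L) simp
    then show "convergent (\<lambda>k. information \<alpha> k x)"
      unfolding information_eq[OF A] by (auto simp: convergent_def)
  qed
qed

text \<open>A null intersection would force density 0, against the lower bound. Positivity is what
  later permits splitting the logarithm of a quotient.\<close>

lemma atom_inter_cell_pos: "AE x in M. \<forall>A\<in>\<alpha>. x \<in> A \<longrightarrow> (\<forall>k. 0 < measure M (A \<inter> B k x))"
proof -
  have "AE x in M. x \<in> A \<longrightarrow> (\<forall>k. 0 < measure M (A \<inter> B k x))" if "A \<in> \<alpha>" for A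
    using cell_density_bounded_below[OF atom_sets[OF that]]
  proof eventually_elim
    case (elim x)
    show ?case
    proof (intro impI allI)
      fix k assume "x \<in> A"
      with elim obtain \<delta> where "0 < \<delta>" "\<delta> \<le> cell_density A k x" by blast
      then have "cell_density A k x \<noteq> 0" by simp
      then have "measure M (A \<inter> B k x) \<noteq> 0" by (auto simp: cell_density_def)
      then show "0 < measure M (A \<inter> B k x)" by (simp add: zero_less_measure_iff)
    qed
  qed
  then show ?thesis using finite_atoms by (intro AE_finite_allI) auto
qed

end

end

text \<open>The error is split into an integrable part of small integral and, for the finitely many small
  indices, a constant; only the former has to be averaged along orbits.\<close>

lemma (in prob_space) dominated_error_split:
  fixes f :: "nat \<Rightarrow> 'a \<Rightarrow> real"
  assumes f [measurable]: "\<And>k. f k \<in> borel_measurable M" and F [measurable]: "F \<in> borel_measurable M"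
    and lim: "AE x in M. (\<lambda>k. f k x) \<longlonglongrightarrow> F x"
    and h: "integrable M h" and bound: "AE x in M. \<forall>k. \<bar>f k x\<bar> \<le> h x"
    and \<epsilon>: "0 < \<epsilon>"
  shows "\<exists>G N. integrable M G \<and> (\<integral>x. G x \<partial>M) < \<epsilon> \<and>
    (AE x in M. \<forall>k. \<bar>f k x - F x\<bar> \<le> G x + (if k < N then real N else 0))"
proof -
  \<comment> \<open>The error left over after an allowance of \<open>N\<close> for each
    \<open>k < N\<close>. The supremum is taken in \<open>ennreal\<close>, where it always exists
    and negative excesses count as 0.\<close>
  define G where "G N x = enn2real (SUP k. ennreal (\<bar>f k x - F x\<bar> - (if k < N then real N else 0)))" for N x
  have G_meas [measurable]: "G N \<in> borel_measurable M" for N unfolding G_def by measurable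
  have bound2: "AE x in M. \<forall>k. \<bar>f k x - F x\<bar> \<le> 2 * h x"
    using lim bound
  proof eventually_elim
    case (elim x)
    have "\<bar>F x\<bar> \<le> h x" using tendsto_rabs[OF elim(1)] elim(2) by (intro LIMSEQ_le_const2) auto
    then show ?case using elim(2) by (metis abs_triangle_ineq4 add_mono mult_2 order_trans)
  qed
  have SUP_le: "(SUP k. ennreal (\<bar>f k x - F x\<bar> - (if k < N then real N else 0))) \<le> ennreal c"
    if "\<And>k. \<bar>f k x - F x\<bar> - (if k < N then real N else 0) \<le> c" for x N c
    using that by (intro SUP_least ennreal_leI)
  have dom: "AE x in M. norm (G N x) \<le> 2 * h x" for N
    using bound2
  proof eventually_elim
    case (elim x)
    have "0 \<le> 2 * h x" using elim abs_ge_zero order_trans by blast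
    have *: "\<bar>f k x - F x\<bar> - (if k < N then real N else 0) \<le> 2 * h x" for k
      using elim[rule_format, of k] by auto
    from SUP_le[OF *] have "G N x \<le> 2 * h x"
      unfolding G_def using \<open>0 \<le> 2 * h x\<close> enn2real_leI by blast
    then show ?case by (simp add: G_def)
  qed
  have G_int: "integrable M (G N)" for N
  proof (rule Bochner_Integration.integrable_bound)
    show "integrable M (\<lambda>x. 2 * h x)" using h by simp
    show "AE x in M. norm (G N x) \<le> norm (2 * h x)"
      using dom[of N] by eventually_elim simp
  qed measurable
  have "(\<lambda>N. \<integral>x. G N x \<partial>M) \<longlonglongrightarrow> (\<integral>x. 0 \<partial>M)"
  proof (rule integral_dominated_convergence[where w = "\<lambda>x. 2 * h x"])
    show "AE x in M. (\<lambda>N. G N x) \<longlonglongrightarrow> 0"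
      using lim bound2
    proof eventually_elim
      case (elim x)
      show ?case
      proof (rule LIMSEQ_I)
        fix r :: real assume "0 < r"
        then obtain K where K: "\<And>k. k \<ge> K \<Longrightarrow> \<bar>f k x - F x\<bar> < r / 2"
          using LIMSEQ_D[OF elim(1), of "r / 2"] by (auto simp del: less_divide_eq_numeral1)
        obtain N0 :: nat where N0: "2 * h x \<le> N0" by (metis real_arch_simple)
        \<comment> \<open>For \<open>k < N\<close> the allowance \<open>N\<close> is at least the
          bound \<open>2 * h x\<close>; for larger \<open>k\<close> the sequence is already close to
          its limit. The margin \<open>r / 2\<close> keeps the inequality strict after the
          supremum.\<close>
        have "norm (G N x - 0) < r" if N: "N \<ge> max K N0" for N
        proof -
          have "\<bar>f k x - F x\<bar> - (if k < N then real N else 0) \<le> r / 2" for k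
          proof (cases "k < N")
            case True
            then show ?thesis using elim(2)[rule_format, of k] N0 N \<open>0 < r\<close> by auto
          next
            case False
            then show ?thesis using K[of k] N by auto
          qed
          from SUP_le[OF this] have "G N x \<le> r / 2"
            unfolding G_def using \<open>0 < r\<close> by (intro enn2real_leI) auto
          then show ?thesis using \<open>0 < r\<close> by (simp add: G_def)
        qed
        then show "\<exists>no. \<forall>n\<ge>no. norm (G n x - 0) < r" by blast
      qed
    qed
    show "integrable M (\<lambda>x. 2 * h x)" using h by simp
    show "AE x in M. norm (G N x) \<le> 2 * h x" for N by (rule dom)
  qed (simp_all add: G_meas)
  then have "eventually (\<lambda>N. (\<integral>x. G N x \<partial>M) < \<epsilon>) sequentially"
    using \<epsilon> by (intro order_tendstoD) auto
  then obtain N where N: "(\<integral>x. G N x \<partial>M) < \<epsilon>" by (auto simp: eventually_sequentially)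
  have "AE x in M. \<forall>k. \<bar>f k x - F x\<bar> \<le> G N x + (if k < N then real N else 0)"
    using bound2
  proof eventually_elim
    case (elim x)
    let ?s = "SUP k. ennreal (\<bar>f k x - F x\<bar> - (if k < N then real N else 0))"
    have *: "\<bar>f k x - F x\<bar> - (if k < N then real N else 0) \<le> 2 * h x" for k
      using elim[rule_format, of k] by auto
    have "?s < \<top>" using SUP_le[OF *] by (rule le_less_trans) simp
    then have s: "?s = ennreal (G N x)" unfolding G_def by simp
    show ?case
    proof
      fix k
      have "ennreal (\<bar>f k x - F x\<bar> - (if k < N then real N else 0)) \<le> ennreal (G N x)"
        unfolding s[symmetric] by (rule SUP_upper) simp
      then have "\<bar>f k x - F x\<bar> - (if k < N then real N else 0) \<le> G N x"
        by (simp add: ennreal_le_iff G_def)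
      then show "\<bar>f k x - F x\<bar> \<le> G N x + (if k < N then real N else 0)" by simp
    qed
  qed
  then show ?thesis using G_int N by blast
qed

section \<open>Invertible ergodic maps\<close>

lemma (in ergodic_system) measurable_funpow [measurable]: "T ^^ n \<in> measurable M M"
  by (induction n) (auto intro: measurable_comp T_measurable)

lemma (in ergodic_system) distr_funpow: "distr M M (T ^^ n) = M"
proof (induction n)
  case 0
  show ?case by (simp add: id_def distr_id)
next
  case (Suc n)
  have "distr M M (T \<circ> T ^^ n) = distr (distr M M (T ^^ n)) M T"
    by (intro distr_distr[symmetric] T_measurable measurable_funpow)
  then show ?case by (simp add: Suc distr_T o_def)
qed

lemma sum_int_interval_split:
  fixes g :: "int \<Rightarrow> real"
  shows "(\<Sum>i\<in>{- int m..int n}. g i) = (\<Sum>j<Suc n. g (int j)) + (\<Sum>j<m. g (- int (Suc j)))"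
proof (induction m)
  case 0
  show ?case
  proof (induction n)
    case (Suc n)
    have "{- int 0..int (Suc n)} = insert (int (Suc n)) {- int 0..int n}" by auto
    then show ?case using Suc by simp
  qed simp
next
  case (Suc m)
  have "{- int (Suc m)..int n} = insert (- int (Suc m)) {- int m..int n}" by auto
  then show ?case using Suc by simp
qed

locale ergodic_automorphism = ergodic_system +
  assumes bij_T: "bij_betw T (space M) (space M)"
    and inv_measurable [measurable]: "inv_into (space M) T \<in> measurable M M"
begin

abbreviation "S \<equiv> inv_into (space M) T"

lemma T_space: "x \<in> space M \<Longrightarrow> T x \<in> space M"
  using bij_T by (auto simp: bij_betw_def)

lemma S_T: "x \<in> space M \<Longrightarrow> S (T x) = x"
  using bij_T by (auto simp: bij_betw_def)

lemma T_S: "x \<in> space M \<Longrightarrow> T (S x) = x"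
  using bij_T by (auto simp: bij_betw_def f_inv_into_f)

text \<open>Preimages under \<open>T\<close> and \<open>S\<close> undo each other, so
  \<open>S\<close> preserves the measure too, and sets invariant under \<open>S\<close> are
  invariant under \<open>T\<close>. This gives the Birkhoff estimates backwards in time.\<close>

sublocale inverse: ergodic_system M S
proof
  show "ergodic_measure M S"
    unfolding ergodic_measure_def
  proof (intro conjI ballI impI)
    fix A assume A: "A \<in> sets M"
    have "S -` A \<inter> space M \<in> sets M" using A by measurable
    moreover have "T -` (S -` A \<inter> space M) \<inter> space M = A"
      using sets.sets_into_space[OF A] by (auto simp: S_T T_space)
    ultimately show "measure M (S -` A \<inter> space M) = measure M A"
      using ergodic by (metis ergodic_measure_def)
    assume inv: "S -` A \<inter> space M = A"
    have "T x \<in> A \<longleftrightarrow> x \<in> A" if "x \<in> space M" for x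
      using that by (subst inv[symmetric]) (simp add: S_T T_space)
    then have "T -` A \<inter> space M = A"
      using sets.sets_into_space[OF A] by auto
    then show "measure M A = 0 \<or> measure M A = 1"
      using ergodic A by (simp add: ergodic_measure_def)
  qed
qed (rule inv_measurable)

section \<open>Integer iterates and two-sided Birkhoff estimates\<close>

definition U :: "int \<Rightarrow> 'a \<Rightarrow> 'a" where "U = iter_int (space M) T"

lemma U_nonneg: "U (int n) = T ^^ n"
  by (simp add: U_def iter_int_def)

lemma U_nonpos: "U (- int n) = S ^^ n"
  by (cases "n = 0") (simp_all add: U_def iter_int_def)

lemma U_cases: obtains n where "j = int n" "U j = T ^^ n" | n where "j = - int n" "U j = S ^^ n"
  by (metis U_nonneg U_nonpos int_cases2)

lemma U_measurable [measurable]: "U j \<in> measurable M M"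
  by (rule U_cases[of j]) auto

lemma distr_U: "distr M M (U j) = M"
  by (rule U_cases[of j]) (simp_all add: distr_funpow inverse.distr_funpow)

lemma U_space: "x \<in> space M \<Longrightarrow> U j x \<in> space M"
  using U_measurable by (rule measurable_space)

lemma U_0 [simp]: "U 0 x = x"
  by (simp add: U_def iter_int_def)

lemma T_U:
  assumes "x \<in> space M"
  shows "T (U j x) = U (j + 1) x"
proof (cases "0 \<le> j")
  case True
  then obtain n where n: "j = int n" using zero_le_imp_eq_int by auto
  have n': "j + 1 = int (Suc n)" using n by simp
  show ?thesis unfolding n' unfolding n U_nonneg by simp
next
  case False
  then obtain n where n: "j = - int (Suc n)" using False by (intro that[of "nat (- j - 1)"]) auto
  have "U j x = S (U (- int n) x)"
    unfolding n U_nonpos by simp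
  moreover have "j + 1 = - int n" using n by simp
  ultimately show ?thesis by (simp add: T_S U_space[OF assms])
qed

text \<open>\<open>T_U\<close> advances the exponent by one; in the downward step of the induction
  \<open>T\<close> is cancelled by \<open>S_T\<close>.\<close>

lemma U_add:
  assumes x: "x \<in> space M"
  shows "U (j + k) x = U j (U k x)"
proof (induction j rule: int_induct[where k = 0])
  case base
  show ?case by simp
next
  case (step1 i)
  have "U (i + 1 + k) x = T (U (i + k) x)" by (simp add: T_U[OF x] algebra_simps)
  then show ?case using step1 by (simp add: T_U[OF U_space[OF x]])
next
  case (step2 i)
  have "T (U (i - 1 + k) x) = T (U (i - 1) (U k x))"
    using step2 by (simp add: T_U[OF x] T_U[OF U_space[OF x]] algebra_simps)
  then show ?case by (metis S_T U_space x)
qed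

lemma AE_U:
  assumes "AE x in M. P x"
  shows "AE x in M. \<forall>i. P (U i x)"
  unfolding AE_all_countable
proof
  fix i
  have "AE x in distr M M (U i). P x" using assms by (subst distr_U)
  then show "AE x in M. P (U i x)" by (rule AE_distrD[OF U_measurable])
qed

text \<open>One constant per point serves all windows, because a window is cut at 0 into a forward
  and a backward segment, both starting at \<open>x\<close>. This counts \<open>x\<close> twice; the
  surplus \<open>?c - \<phi> x\<close> goes into the constant.\<close>

lemma birkhoff_two_sided:
  fixes \<phi> :: "'a \<Rightarrow> real"
  assumes \<phi>: "integrable M \<phi>" and e: "0 < e"
  shows "AE x in M. \<exists>C. \<forall>m n. (\<Sum>i\<in>{- int m..int n}. \<phi> (U i x)) \<le> real (n + m + 1) * ((\<integral>x. \<phi> x \<partial>M) + e) + C"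
  using birkhoff_upper[OF \<phi> e] inverse.birkhoff_upper[OF \<phi> e]
proof eventually_elim
  case (elim x)
  let ?c = "(\<integral>x. \<phi> x \<partial>M) + e"
  obtain C1 where C1: "\<And>n. (\<Sum>j<n. \<phi> ((T ^^ j) x)) \<le> real n * ?c + C1" using elim(1) by blast
  obtain C2 where C2: "\<And>n. (\<Sum>j<n. \<phi> ((S ^^ j) x)) \<le> real n * ?c + C2" using elim(2) by blast
  have "(\<Sum>i\<in>{- int m..int n}. \<phi> (U i x)) \<le> real (n + m + 1) * ?c + (?c + C1 + C2 - \<phi> x)" for m n
  proof -
    have "(\<Sum>i\<in>{- int m..int n}. \<phi> (U i x)) = (\<Sum>j<Suc n. \<phi> ((T ^^ j) x)) + (\<Sum>j<m. \<phi> ((S ^^ Suc j) x))"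
      by (simp only: sum_int_interval_split U_nonneg U_nonpos)
    also have "(\<Sum>j<m. \<phi> ((S ^^ Suc j) x)) = (\<Sum>j<Suc m. \<phi> ((S ^^ j) x)) - \<phi> x"
      unfolding sum.lessThan_Suc_shift by simp
    also have "(\<Sum>j<Suc n. \<phi> ((T ^^ j) x)) + \<dots> \<le>
        (real (Suc n) * ?c + C1) + ((real (Suc m) * ?c + C2) - \<phi> x)"
      by (intro add_mono diff_mono C1 C2) simp
    also have "\<dots> = real (n + m + 1) * ?c + (?c + C1 + C2 - \<phi> x)"
      by (simp add: algebra_simps)
    finally show ?thesis .
  qed
  then show ?case by blast
qed

end

section \<open>The Shannon--McMillan--Breiman theorem over windows\<close>

text \<open>Members of a common refinement are intersections given by choice functions. Describing
  them by membership removes the choice; \<open>J \<noteq> {}\<close> keeps the intersection inside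
  \<open>X\<close>.\<close>

lemma join_partition_eqI:
  assumes J: "J \<noteq> {}" and part: "\<And>j. j \<in> J \<Longrightarrow> partition_on X (shift_partition X T j \<alpha>)"
    and C: "C \<in> join_partition X T J \<alpha>" "x \<in> C"
  shows "C = {y \<in> X. \<forall>j\<in>J. \<forall>R\<in>shift_partition X T j \<alpha>. y \<in> R \<longleftrightarrow> x \<in> R}"
proof -
  let ?P = "\<lambda>j. shift_partition X T j \<alpha>"
  obtain F where F: "F \<in> (\<Pi> P\<in>?P ` J. P)" "C = (\<Inter>P\<in>?P ` J. F P)"
    using C unfolding join_partition_def common_refinement by auto
  have mem: "F (?P j) \<in> ?P j" "x \<in> F (?P j)" if "j \<in> J" for j
    using F C that by auto
  have disj: "R = R'" if "j \<in> J" "R \<in> ?P j" "R' \<in> ?P j" "y \<in> R" "y \<in> R'" for j R R' y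
    using part[OF that(1)] that unfolding partition_on_def disjoint_def by blast
  have sub: "R \<subseteq> X" if "j \<in> J" "R \<in> ?P j" for j R
    using part[OF that(1)] that(2) unfolding partition_on_def by blast
  show ?thesis
  proof (intro equalityI subsetI)
    fix y assume "y \<in> C"
    then have y: "y \<in> F (?P j)" if "j \<in> J" for j using F that by auto
    moreover have "y \<in> X" using J mem y sub by blast
    moreover have "y \<in> R \<longleftrightarrow> x \<in> R" if "j \<in> J" "R \<in> ?P j" for j R
      using disj[OF that(1,2) mem(1)[OF that(1)]] y[OF that(1)] mem(2)[OF that(1)] by blast
    ultimately show "y \<in> {y \<in> X. \<forall>j\<in>J. \<forall>R\<in>?P j. y \<in> R \<longleftrightarrow> x \<in> R}" by blast
  next
    fix y assume "y \<in> {y \<in> X. \<forall>j\<in>J. \<forall>R\<in>?P j. y \<in> R \<longleftrightarrow> x \<in> R}"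
    then show "y \<in> C" using F mem by auto
  qed
qed

locale partition_system = ergodic_automorphism +
  fixes \<alpha> :: "'a set set"
  assumes \<alpha>: "finite_measurable_partition M \<alpha>"
begin

text \<open>Since \<open>y \<in> T\<^sup>j A\<close> iff \<open>T\<^sup>-\<^sup>j y \<in> A\<close>, this is the cell of the join of the \<open>T\<^sup>j \<alpha>\<close> with
  \<open>j \<in> J\<close> around \<open>x\<close>.\<close>

definition window :: "int set \<Rightarrow> 'a \<Rightarrow> 'a set" where
  "window J x = {y \<in> space M. \<forall>j\<in>J. \<forall>A\<in>\<alpha>. U (- j) y \<in> A \<longleftrightarrow> U (- j) x \<in> A}"

lemma window_sets:
  assumes "finite J"
  shows "window J x \<in> sets M"
proof -
  have "{y \<in> space M. U (- j) y \<in> A \<longleftrightarrow> U (- j) x \<in> A} \<in> sets M" if "A \<in> \<alpha>" for j A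
  proof -
    have [measurable]: "A \<in> sets M" using that \<alpha> by (auto simp: finite_measurable_partition_def)
    show ?thesis by measurable
  qed
  then show ?thesis unfolding window_def using assms \<alpha>
    by (intro sets.sets_Collect_finite_All) (auto simp: finite_measurable_partition_def)
qed

lemma window_self: "x \<in> space M \<Longrightarrow> x \<in> window J x"
  by (simp add: window_def)

lemma window_eq: "y \<in> window J x \<Longrightarrow> window J y = window J x"
  by (simp add: window_def)

lemma window_antimono: "J \<subseteq> J' \<Longrightarrow> window J' x \<subseteq> window J x"
  unfolding window_def by blast

lemma window_empty: "window {} x = space M"
  by (simp add: window_def)

text \<open>A window depends only on the set of pairs \<open>(j, A)\<close> with
  \<open>U (- j) x \<in> A\<close>, a subset of a finite product.\<close>

lemma finite_windows:
  assumes "finite J"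
  shows "finite (window J ` space M)"
proof (rule finite_subset)
  let ?w = "\<lambda>Q. {y \<in> space M. \<forall>j\<in>J. \<forall>A\<in>\<alpha>. U (- j) y \<in> A \<longleftrightarrow> (j, A) \<in> Q}"
  show "window J ` space M \<subseteq> ?w ` Pow (J \<times> \<alpha>)"
  proof
    fix W assume "W \<in> window J ` space M"
    then obtain x where "W = window J x" by blast
    then have "W = ?w {(j, A) \<in> J \<times> \<alpha>. U (- j) x \<in> A}" by (auto simp: window_def)
    then show "W \<in> ?w ` Pow (J \<times> \<alpha>)" by (rule image_eqI) auto
  qed
  show "finite (?w ` Pow (J \<times> \<alpha>))"
    using assms \<alpha> by (simp add: finite_measurable_partition_def)
qed

text \<open>The preimage of the left window under the measure preserving \<open>U k\<close> is the
  translated window around \<open>x\<close>, because \<open>U (- j)\<close> after \<open>U k\<close>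
  is \<open>U (- j + k)\<close>.\<close>

lemma measure_window_shift:
  assumes x: "x \<in> space M"
  shows "measure M (window {a..b} (U k x)) = measure M (window {a - k..b - k} x)"
proof -
  have "U k -` window {a..b} (U k x) \<inter> space M = window {a - k..b - k} x"
  proof -
    have "(\<forall>j\<in>{a..b}. Q (- j + k)) \<longleftrightarrow> (\<forall>j\<in>{a - k..b - k}. Q (- j))" for Q :: "int \<Rightarrow> bool"
    proof
      assume Q: "\<forall>j\<in>{a..b}. Q (- j + k)"
      show "\<forall>j\<in>{a - k..b - k}. Q (- j)"
      proof
        fix j assume "j \<in> {a - k..b - k}"
        then show "Q (- j)" using Q[rule_format, of "j + k"] by simp
      qed
    next
      assume Q: "\<forall>j\<in>{a - k..b - k}. Q (- j)"
      show "\<forall>j\<in>{a..b}. Q (- j + k)"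
      proof
        fix j assume "j \<in> {a..b}"
        then show "Q (- j + k)" using Q[rule_format, of "j - k"] by simp
      qed
    qed
    note shift = this[of "\<lambda>i. \<forall>A\<in>\<alpha>. U i y \<in> A \<longleftrightarrow> U i x \<in> A" for y]
    show ?thesis
    proof (rule set_eqI)
      fix y
      show "y \<in> U k -` window {a..b} (U k x) \<inter> space M \<longleftrightarrow> y \<in> window {a - k..b - k} x"
      proof (cases "y \<in> space M")
        case True
        then have "y \<in> U k -` window {a..b} (U k x) \<inter> space M \<longleftrightarrow>
            (\<forall>j\<in>{a..b}. \<forall>A\<in>\<alpha>. U (- j + k) y \<in> A \<longleftrightarrow> U (- j + k) x \<in> A)"
          unfolding window_def U_add[OF True] U_add[OF x] by (simp add: U_space)
        then show ?thesis unfolding shift by (simp add: window_def True)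
      qed (simp add: window_def)
    qed
  qed
  moreover have "measure M (window {a..b} (U k x)) = measure (distr M M (U k)) (window {a..b} (U k x))"
    by (simp add: distr_U)
  ultimately show ?thesis
    by (subst (asm) measure_distr) (auto intro: window_sets)
qed

text \<open>Index 0 is left out, as it carries the atom whose information is measured. For
  \<open>k = 0\<close> the interval is empty and the partition trivial.\<close>

sublocale cells: nested_cells M "\<lambda>k. window {1..int k}"
proof
  show "window {1..int k} x \<in> sets M" for k x by (rule window_sets) simp
  show "x \<in> window {1..int k} x" if "x \<in> space M" for x k using that by (rule window_self)
  show "window {1..int k} y = window {1..int k} x" if "y \<in> window {1..int k} x" for x y k
    using that by (rule window_eq)
  show "window {1..int (Suc k)} x \<subseteq> window {1..int k} x" for k x by (rule window_antimono) auto
  show "finite (window {1..int k} ` space M)" for k by (rule finite_windows) simp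
qed

abbreviation "info \<equiv> cells.information \<alpha>"

text \<open>Cutting with the atom adds index 0. Hence, where the measures are positive,
  \<open>info k x\<close> is the increase of \<open>- ln\<close> of the measure when the window
  \<open>{1..k}\<close> is extended to \<open>{0..k}\<close>.\<close>

lemma atom_Int_window:
  assumes x: "x \<in> space M" and A: "A \<in> \<alpha>" "x \<in> A"
  shows "A \<inter> window {1..int k} x = window {0..int k} x"
proof -
  have "y \<in> A \<longleftrightarrow> (\<forall>A'\<in>\<alpha>. y \<in> A' \<longleftrightarrow> x \<in> A')" for y
    using A cells.atom_unique[OF \<alpha>] by blast
  moreover have "{0..int k} = insert 0 {1..int k}" by auto
  ultimately show ?thesis by (auto simp: window_def)
qed

lemma info_eq:
  assumes x: "x \<in> space M"
  shows "info k x = - ln (measure M (window {0..int k} x) / measure M (window {1..int k} x))"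
proof -
  obtain A where A: "A \<in> \<alpha>" "x \<in> A" using cells.atom_exists[OF \<alpha> x] by blast
  show ?thesis
    by (simp only: cells.information_eq[OF \<alpha> A] cells.cell_density_def atom_Int_window[OF x A])
qed

text \<open>The whole orbit is covered because the chain rule for windows evaluates
  \<open>info\<close> at all \<open>U (- i) x\<close>.\<close>

lemma window_pos: "AE x in M. \<forall>i k. 0 < measure M (window {0..int k} (U i x))"
proof -
  have "AE x in M. \<forall>k. 0 < measure M (window {0..int k} x)"
    using cells.atom_inter_cell_pos[OF \<alpha>] AE_space
  proof eventually_elim
    case (elim x)
    obtain A where A: "A \<in> \<alpha>" "x \<in> A" using cells.atom_exists[OF \<alpha> elim(2)] by blast
    then show ?case using elim(1) atom_Int_window[OF elim(2) A] by auto
  qed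
  from AE_U[OF this] show ?thesis .
qed

text \<open>The chain rule for information. With the right end \<open>b\<close> fixed, each step
  prepends the index \<open>b - int n\<close>; translating it to 0 turns the quotient of measures
  into \<open>info n\<close> at \<open>U (int n - b) x\<close>. The left end
  \<open>b + 1 - int n\<close> makes \<open>n = 0\<close> the empty window, of measure 1.\<close>

lemma neg_ln_measure_window:
  assumes x: "x \<in> space M" and pos: "\<forall>i k. 0 < measure M (window {0..int k} (U i x))"
  shows "- ln (measure M (window {b + 1 - int n..b} x)) = (\<Sum>i\<in>{b + 1 - int n..b}. info (nat (b - i)) (U (- i) x))"
proof (induction n)
  case 0
  show ?case by (simp add: window_empty prob_space)
next
  case (Suc n)
  define a where "a = b - int n"
  have eq: "{b + 1 - int (Suc n)..b} = {a..b}" "{b + 1 - int n..b} = {a + 1..b}" by (auto simp: a_def)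
  have insert: "{a..b} = insert a {a + 1..b}" by (auto simp: a_def)
  have w: "measure M (window {0..int n} (U (- a) x)) = measure M (window {a..b} x)"
    "measure M (window {1..int n} (U (- a) x)) = measure M (window {a + 1..b} x)"
    using measure_window_shift[OF x, of 0 "int n" "- a"] measure_window_shift[OF x, of 1 "int n" "- a"]
    by (simp_all add: a_def algebra_simps)
  have p: "0 < measure M (window {a..b} x)" using pos w(1) by metis
  have "measure M (window {a..b} x) \<le> measure M (window {a + 1..b} x)"
    by (intro finite_measure_mono window_antimono window_sets) auto
  with p have p': "0 < measure M (window {a + 1..b} x)" by simp
  have "info n (U (- a) x) = - ln (measure M (window {a..b} x)) + ln (measure M (window {a + 1..b} x))"
    unfolding info_eq[OF U_space[OF x]] w using p p' by (simp add: ln_div)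
  then show ?case using Suc unfolding eq insert by (simp add: a_def)
qed

section \<open>The limiting information function and the asymptotics of windows\<close>

definition past_info :: "'a \<Rightarrow> real" where "past_info x = lim (\<lambda>k. info k x)"

lemma past_info_measurable [measurable]: "past_info \<in> borel_measurable M"
  unfolding past_info_def using cells.information_measurable[OF \<alpha>] by (rule borel_measurable_lim_metric)

lemma info_tendsto: "AE x in M. (\<lambda>k. info k x) \<longlonglongrightarrow> past_info x"
  using cells.information_convergent[OF \<alpha>] by (rule AE_mp) (auto simp: past_info_def convergent_LIMSEQ_iff)

lemma past_info_integrable: "integrable M past_info"
  and integral_info_tendsto: "(\<lambda>k. \<integral>x. info k x \<partial>M) \<longlonglongrightarrow> (\<integral>x. past_info x \<partial>M)"
proof -
  obtain h where h: "integrable M h" and b: "AE x in M. \<forall>k. \<bar>info k x\<bar> \<le> h x"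
    using cells.information_dominated[OF \<alpha>] by blast
  have b': "AE x in M. norm (info k x) \<le> h x" for k
    using b by eventually_elim simp
  note dct = past_info_measurable cells.information_measurable[OF \<alpha>] h info_tendsto b'
  show "integrable M past_info" by (rule integrable_dominated_convergence[OF dct])
  show "(\<lambda>k. \<integral>x. info k x \<partial>M) \<longlonglongrightarrow> (\<integral>x. past_info x \<partial>M)" by (rule integral_dominated_convergence[OF dct])
qed

text \<open>The term at orbit position \<open>i\<close> is conditioned on \<open>m + i\<close>
  partitions only, so near the left end it may be far from \<open>past_info\<close>.
  \<open>dominated_error_split\<close> charges a fixed amount for the first \<open>N\<close>
  positions to the constant and the rest to Birkhoff sums of \<open>G\<close>.\<close>

lemma window_estimate:
  assumes \<epsilon>: "0 < \<epsilon>"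
  shows "AE x in M. \<exists>C. \<forall>n m. \<bar>- ln (measure M (window {- int n..int m} x)) - real (n + m + 1) * (\<integral>x. past_info x \<partial>M)\<bar>
    \<le> real (n + m + 1) * \<epsilon> + C"
proof -
  define e where "e = \<epsilon> / 4"
  have e: "0 < e" using \<epsilon> by (simp add: e_def)
  obtain h where h: "integrable M h" and b: "AE x in M. \<forall>k. \<bar>info k x\<bar> \<le> h x"
    using cells.information_dominated[OF \<alpha>] by blast
  obtain G N where G: "integrable M G" "(\<integral>x. G x \<partial>M) < e"
    and GN: "AE x in M. \<forall>k. \<bar>info k x - past_info x\<bar> \<le> G x + (if k < N then real N else 0)"
    using dominated_error_split[OF cells.information_measurable[OF \<alpha>] past_info_measurable info_tendsto h b e] by blast
  have mF: "integrable M (\<lambda>x. - past_info x)" using past_info_integrable by simp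
  show ?thesis
    using birkhoff_two_sided[OF G(1) e] birkhoff_two_sided[OF past_info_integrable e] birkhoff_two_sided[OF mF e]
      AE_U[OF GN] window_pos AE_space
  proof eventually_elim
    case (elim x)
    let ?h = "\<integral>x. past_info x \<partial>M"
    obtain C1 where C1: "\<And>m n. (\<Sum>i\<in>{- int m..int n}. G (U i x)) \<le> real (n + m + 1) * ((\<integral>x. G x \<partial>M) + e) + C1"
      using elim(1) by blast
    obtain C2 where C2: "\<And>m n. (\<Sum>i\<in>{- int m..int n}. past_info (U i x)) \<le> real (n + m + 1) * (?h + e) + C2"
      using elim(2) by blast
    obtain C3 where C3: "\<And>m n. (\<Sum>i\<in>{- int m..int n}. - past_info (U i x)) \<le> real (n + m + 1) * ((\<integral>x. - past_info x \<partial>M) + e) + C3"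
      using elim(3) by blast
    have "\<bar>- ln (measure M (window {- int n..int m} x)) - real (n + m + 1) * ?h\<bar>
      \<le> real (n + m + 1) * \<epsilon> + (\<bar>C1\<bar> + \<bar>C2\<bar> + \<bar>C3\<bar> + real N * real N)" for n m
    proof -
      let ?s = "real (n + m + 1)"
      let ?L = "- ln (measure M (window {- int n..int m} x))"
      have "{int m + 1 - int (Suc (n + m))..int m} = {- int n..int m}" by auto
      then have "?L = (\<Sum>i\<in>{- int n..int m}. info (nat (int m - i)) (U (- i) x))"
        using neg_ln_measure_window[OF elim(6,5), of "int m" "Suc (n + m)"] by simp
      also have "\<dots> = (\<Sum>i\<in>{- int m..int n}. info (nat (int m + i)) (U i x))"
        by (rule sum.reindex_bij_witness[of _ uminus uminus]) auto
      finally have "\<bar>?L - (\<Sum>i\<in>{- int m..int n}. past_info (U i x))\<bar> =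
          \<bar>\<Sum>i\<in>{- int m..int n}. info (nat (int m + i)) (U i x) - past_info (U i x)\<bar>"
        by (simp add: sum_subtractf)
      also have "\<dots> \<le> (\<Sum>i\<in>{- int m..int n}. \<bar>info (nat (int m + i)) (U i x) - past_info (U i x)\<bar>)"
        by (rule sum_abs)
      also have "\<dots> \<le> (\<Sum>i\<in>{- int m..int n}. G (U i x) + (if nat (int m + i) < N then real N else 0))"
        using elim(4) by (intro sum_mono) blast
      also have "\<dots> = (\<Sum>i\<in>{- int m..int n}. G (U i x)) +
          (\<Sum>i\<in>{- int m..int n}. if nat (int m + i) < N then real N else 0)"
        by (rule sum.distrib)
      \<comment> \<open>Only positions with \<open>- m \<le> i < N - m\<close> contribute, at most
        \<open>N\<close> of them with value \<open>N\<close>, whatever \<open>n\<close> and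
        \<open>m\<close> are.\<close>
      also have "(\<Sum>i\<in>{- int m..int n}. if nat (int m + i) < N then real N else 0) \<le> real N * real N"
      proof -
        have "(\<Sum>i\<in>{- int m..int n}. if nat (int m + i) < N then real N else 0) =
            (\<Sum>i\<in>{- int m..int n} \<inter> {i. nat (int m + i) < N}. real N)"
          by (subst sum.inter_restrict) auto
        also have "\<dots> \<le> (\<Sum>i\<in>{- int m..<int N - int m}. real N)"
          by (intro sum_mono2) auto
        finally show ?thesis by simp
      qed
      finally have 1: "\<bar>?L - (\<Sum>i\<in>{- int m..int n}. past_info (U i x))\<bar> \<le> ?s * ((\<integral>x. G x \<partial>M) + e) + C1 + real N * real N"
        using C1[of m n] by linarith
      have "?s * ((\<integral>x. G x \<partial>M) + e) \<le> ?s * (2 * e)"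
        using G(2) by (intro mult_left_mono) auto
      moreover have "\<bar>(\<Sum>i\<in>{- int m..int n}. past_info (U i x)) - ?s * ?h\<bar> \<le> ?s * e + \<bar>C2\<bar> + \<bar>C3\<bar>"
        using C2[of m n] C3[of m n] by (simp add: sum_negf algebra_simps abs_le_iff) linarith
      moreover have "?s * \<epsilon> = ?s * (2 * e) + ?s * e + ?s * e" by (simp add: e_def field_simps)
      moreover have "0 \<le> ?s * e" using e by simp
      ultimately show ?thesis using 1 by linarith
    qed
    then show ?case by blast
  qed
qed

text \<open>The constant depends on the point and on the precision, so the estimate is taken for
  countably many precisions \<open>1 / Suc p\<close> at once; dividing by \<open>n + m\<close> then
  removes the constant.\<close>

lemma window_limit:
  "AE x in M. ((\<lambda>(n, m). - 1 / real (n + m) * ln (measure M (window {- int n..int m} x)))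
    \<longlongrightarrow> (\<integral>x. past_info x \<partial>M)) sum_at_top"
proof -
  let ?h = "\<integral>x. past_info x \<partial>M"
  have "AE x in M. \<forall>p::nat. \<exists>C. \<forall>n m. \<bar>- ln (measure M (window {- int n..int m} x)) - real (n + m + 1) * ?h\<bar>
    \<le> real (n + m + 1) * (1 / real (Suc p)) + C"
    unfolding AE_all_countable by (intro allI window_estimate) simp
  then show ?thesis
  proof eventually_elim
    case (elim x)
    show ?case unfolding tendsto_sum_at_top_iff
    proof (intro allI impI)
      fix \<epsilon> :: real assume \<epsilon>: "0 < \<epsilon>"
      then obtain p :: nat where p: "1 / real (Suc p) < \<epsilon> / 4"
        using nat_approx_posE[of "\<epsilon> / 4"] by auto
      obtain C where C: "\<And>n m. \<bar>- ln (measure M (window {- int n..int m} x)) - real (n + m + 1) * ?h\<bar>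
        \<le> real (n + m + 1) * (1 / real (Suc p)) + C" using elim by blast
      \<comment> \<open>\<open>K\<close> absorbs both \<open>C\<close> and the additional
        \<open>?h\<close> caused by the factor \<open>n + m + 1\<close> in place of
        \<open>n + m\<close>; together they take half of \<epsilon>.\<close>
      obtain K :: nat where K: "2 * (\<bar>C\<bar> + \<bar>?h\<bar>) / \<epsilon> < real K" using reals_Archimedean2 by blast
      have "\<bar>(case (n, m) of (n, m) \<Rightarrow> - 1 / real (n + m) * ln (measure M (window {- int n..int m} x))) - ?h\<bar> < \<epsilon>"
        if nm: "max 1 K \<le> n + m" for n m
      proof -
        let ?L = "- ln (measure M (window {- int n..int m} x))"
        define s where "s = real (n + m)"
        define d where "d = 1 / real (Suc p)"
        have s: "1 \<le> s" "real K \<le> s" using nm by (auto simp: s_def simp flip: of_nat_add)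
        have "2 * (\<bar>C\<bar> + \<bar>?h\<bar>) / \<epsilon> < s" using K s by linarith
        then have "2 * (\<bar>C\<bar> + \<bar>?h\<bar>) < s * \<epsilon>" using \<epsilon> by (simp add: divide_less_eq)
        \<comment> \<open>As \<open>s\<close> is at least 1 by the choice of \<open>max 1 K\<close>,
          \<open>s + 1 \<le> 2 * s\<close>, so a quarter of \<epsilon> becomes the other
          half.\<close>
        moreover have "(s + 1) * d \<le> (2 * s) * (\<epsilon> / 4)"
          using s p by (intro mult_mono) (auto simp: d_def)
        moreover have "\<bar>?L - (s + 1) * ?h\<bar> \<le> (s + 1) * d + C"
          using C[of n m] by (simp add: s_def d_def add_ac)
        moreover have "\<bar>?L - s * ?h\<bar> \<le> \<bar>?L - (s + 1) * ?h\<bar> + \<bar>?h\<bar>"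
          using abs_triangle_ineq[of "?L - (s + 1) * ?h" ?h] by (simp add: algebra_simps)
        moreover have "C \<le> \<bar>C\<bar>" by simp
        ultimately have "\<bar>?L - s * ?h\<bar> < s * \<epsilon>" by (simp add: field_simps)
        then have "\<bar>?L - s * ?h\<bar> / s < \<epsilon>" using s by (simp add: divide_less_eq mult.commute)
        moreover have "\<bar>?L - s * ?h\<bar> / s = \<bar>?L / s - ?h\<bar>"
        proof -
          have "?L / s - ?h = (?L - s * ?h) / s" using s by (simp add: field_simps)
          then show ?thesis using s by simp
        qed
        ultimately show ?thesis by (simp add: s_def)
      qed
      then show "\<exists>K. \<forall>n m. K \<le> n + m \<longrightarrow>
          \<bar>(case (n, m) of (n, m) \<Rightarrow> - 1 / real (n + m) * ln (measure M (window {- int n..int m} x))) - ?h\<bar> < \<epsilon>"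
        by blast
    qed
  qed
qed

section \<open>Windows as cells of joins, and the entropy\<close>

lemma mem_U_image:
  assumes "y \<in> space M" "A \<in> \<alpha>"
  shows "y \<in> U j ` A \<longleftrightarrow> U (- j) y \<in> A"
proof -
  have A: "A \<subseteq> space M" using cells.atom_sets[OF \<alpha> assms(2)] by (rule sets.sets_into_space)
  show ?thesis
  proof
    assume "y \<in> U j ` A"
    then obtain z where z: "z \<in> A" "y = U j z" by blast
    then have "U (- j) y = z" using A U_add[of z "- j" j] by auto
    then show "U (- j) y \<in> A" using z by simp
  next
    assume "U (- j) y \<in> A"
    moreover have "y = U j (U (- j) y)" using U_add[OF assms(1), of j "- j"] by simp
    ultimately show "y \<in> U j ` A" by blast
  qed
qed

lemma U_image_subset: "A \<in> \<alpha> \<Longrightarrow> U j ` A \<subseteq> space M"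
  using cells.atom_sets[OF \<alpha>] sets.sets_into_space U_space by blast

lemma shift_partition_eq: "shift_partition (space M) T j \<alpha> = (\<lambda>A. U j ` A) ` \<alpha>"
  by (simp add: shift_partition_def U_def)

lemma partition_on_shift: "partition_on (space M) (shift_partition (space M) T j \<alpha>)"
  unfolding shift_partition_eq
proof (rule partition_onI)
  show "\<Union> ((\<lambda>A. U j ` A) ` \<alpha>) = space M"
  proof (intro equalityI subsetI)
    fix y assume y: "y \<in> space M"
    obtain A where "A \<in> \<alpha>" "U (- j) y \<in> A" using cells.atom_exists[OF \<alpha> U_space[OF y]] by blast
    then show "y \<in> \<Union> ((\<lambda>A. U j ` A) ` \<alpha>)" using mem_U_image[OF y] by blast
  qed (use U_image_subset in blast)
  show "disjnt R R'" if R: "R \<in> (\<lambda>A. U j ` A) ` \<alpha>" "R' \<in> (\<lambda>A. U j ` A) ` \<alpha>" "R \<noteq> R'" for R R'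
  proof -
    obtain A A' where A: "A \<in> \<alpha>" "A' \<in> \<alpha>" "R = U j ` A" "R' = U j ` A'" using R by blast
    have "A = A'" if y: "y \<in> R" "y \<in> R'" for y
    proof -
      have "y \<in> space M" using y(1) U_image_subset[OF A(1)] A(3) by blast
      then have "U (- j) y \<in> A" "U (- j) y \<in> A'" using y A mem_U_image by simp_all
      then show ?thesis using cells.atom_unique[OF \<alpha> A(1,2)] by blast
    qed
    then show ?thesis using A R(3) by (auto simp: disjnt_iff)
  qed
  show "{} \<notin> (\<lambda>A. U j ` A) ` \<alpha>"
    using \<alpha> by (auto simp: finite_measurable_partition_def partition_on_def)
qed

lemma join_cell_eq_window:
  assumes "J \<noteq> {}" "C \<in> join_partition (space M) T J \<alpha>" "x \<in> C"
  shows "C = window J x"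
proof -
  have C: "C = {y \<in> space M. \<forall>j\<in>J. \<forall>R\<in>shift_partition (space M) T j \<alpha>. y \<in> R \<longleftrightarrow> x \<in> R}"
    using assms by (intro join_partition_eqI partition_on_shift)
  then have "x \<in> space M" using assms(3) by blast
  then show ?thesis unfolding C window_def shift_partition_eq
    by (simp add: mem_U_image cong: conj_cong ball_cong)
qed

lemma partition_on_join: "J \<noteq> {} \<Longrightarrow> partition_on (space M) (join_partition (space M) T J \<alpha>)"
  unfolding join_partition_def using partition_on_shift by (intro partition_on_common_refinement) auto

lemma window_in_join:
  assumes "J \<noteq> {}" "x \<in> space M"
  shows "window J x \<in> join_partition (space M) T J \<alpha>"
proof -
  obtain C where "C \<in> join_partition (space M) T J \<alpha>" "x \<in> C"
    using partition_onD1[OF partition_on_join[OF assms(1)]] assms(2) by blast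
  then show ?thesis using join_cell_eq_window[OF assms(1)] by metis
qed

lemma cell_eq_window:
  assumes x: "x \<in> space M"
  shows "cell (space M) T \<alpha> n m x = window {- int n..int m} x"
proof -
  have "{- int n..int m} \<noteq> {}" by auto
  then show ?thesis unfolding cell_def
    using window_in_join[OF _ x] window_self[OF x] join_cell_eq_window by (intro the_equality) auto
qed

text \<open>Of the sum over the join only the cell of \<open>x\<close> survives, which is a window.
  For \<open>n = 0\<close> the join is over no partitions at all and need not partition the
  space.\<close>

lemma cond_information_eq_info:
  assumes x: "x \<in> space M" and n: "0 < n"
  shows "cond_information M \<alpha> (join_partition (space M) T {1..int n} \<alpha>) x = info n x"
proof -
  let ?J = "{1..int n}" and ?\<beta> = "join_partition (space M) T {1..int n} \<alpha>"
  have J: "?J \<noteq> {}" using n by auto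
  have fin: "finite ?\<beta>"
    unfolding join_partition_def shift_partition_eq using cells.finite_atoms[OF \<alpha>]
    by (intro finite_common_refinement) auto
  let ?g = "\<lambda>A B. indicator (A \<inter> B) x * ln (measure M (A \<inter> B) / measure M B)"
  have "(\<Sum>B\<in>?\<beta>. ?g A B) = indicator A x * ln (cells.cell_density A n x)" for A
  proof -
    have "(\<Sum>B\<in>?\<beta>. ?g A B) = (\<Sum>B\<in>{window ?J x}. ?g A B)"
      using fin window_in_join[OF J x] join_cell_eq_window[OF J]
      by (intro sum.mono_neutral_right) (auto simp: indicator_def)
    also have "\<dots> = ?g A (window ?J x)"
      by (subst sum.insert) simp_all
    also have "\<dots> = indicator A x * ln (cells.cell_density A n x)"
      using window_self[OF x] by (auto simp: cells.cell_density_def indicator_def)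
    finally show ?thesis .
  qed
  then show ?thesis by (simp add: cond_information_def cells.information_def sum_negf)
qed

text \<open>The sequence defining the entropy agrees with the integrals of \<open>info n\<close>
  from \<open>n = 1\<close> on, so both have the same limit.\<close>

lemma metric_entropy_eq: "metric_entropy M T \<alpha> = (\<integral>x. past_info x \<partial>M)"
proof -
  have "(\<integral>x. cond_information M \<alpha> (join_partition (space M) T {1..int n} \<alpha>) x \<partial>M) = (\<integral>x. info n x \<partial>M)" if "0 < n" for n
    using cond_information_eq_info that by (intro Bochner_Integration.integral_cong) auto
  then have "eventually (\<lambda>n. (\<integral>x. info n x \<partial>M) =
      (\<integral>x. cond_information M \<alpha> (join_partition (space M) T {1..int n} \<alpha>) x \<partial>M)) sequentially"
    by (intro eventually_mono[OF eventually_gt_at_top[of 0]]) simp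
  with integral_info_tendsto show ?thesis
    unfolding metric_entropy_def by (intro limI) (rule Lim_transform_eventually)
qed

end

theorem theorem2:
  fixes X :: "'a::topological_space set" and M :: "'a measure"
    and T :: "'a \<Rightarrow> 'a" and \<alpha> :: "'a set set"
  assumes "compact X"
    and "space M = X" and "sets M = sets (restrict_space borel X)"
    and "prob_space M"
    and "bij_betw T X X"
    and "T \<in> measurable M M" and "inv_into X T \<in> measurable M M"
    and "ergodic_measure M T"
    and "finite_measurable_partition M \<alpha>"
  shows "AE x in M.
    ((\<lambda>(n, m). - 1 / real (n + m) * ln (measure M (cell X T \<alpha> n m x)))
       \<longlongrightarrow> metric_entropy M T \<alpha>) sum_at_top"
proof -
  interpret prob_space M by fact
  interpret partition_system M T \<alpha>
    using assms by unfold_locales auto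
  show ?thesis
    using window_limit AE_space
  proof eventually_elim
    case (elim x)
    then show ?case
      using cell_eq_window \<open>space M = X\<close> by (simp add: metric_entropy_eq)
  qed
qed

end
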